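(* Let $a,b>-1$, $k\in\mathbb N_0$, and $s>k+1+\max\{a+k,\ b+k,\ -1/2\}$. Then there is a continuous embedding $H^s_{(a,b)}(\mathrm I)\subset C^k(\mathrm I)$ of $H^s_{(a,b)}(\mathrm I)$ into the Banach space $C^k(\mathrm I)$ with the norm $\|v\|_{C^k}=\|v\|_\infty+\|v^{(k)}\|_\infty$.
   Context: $\mathrm I=(0,1)$, $\mathbb N_0=\mathbb N\cup\{0\}$, $\rho^{(a,b)}(x)=(1-x)^ax^b$, $L^2_{\rho^{(a,b)}}(\mathrm I)=\{v:\int_0^1\rho^{(a,b)}v^2dx<\infty\}$. Let $G_j^{(a,b)}(x)=P_j^{(a,b)}(2x-1)$, where $P_j^{(a,b)}$ is the Jacobi polynomial on $(-1,1)$ (orthogonal for the weight $(1-t)^a(1+t)^b$), $\widetilde G_j^{(a,b)}=G_j^{(a,b)}/\big(\int_0^1\rho^{(a,b)}(G_j^{(a,b)})^2dx\big)^{1/2}$, and $v_j=\int_0^1\rho^{(a,b)}v\,\widetilde G_j^{(a,b)}dx$. For $s\ge0$, $H^s_{(a,b)}(\mathrm I)=\{v\in L^2_{\rho^{(a,b)}}(\mathrm I):\ \|v\|_{s,(a,b)}^2:=\sum_{j\ge0}(1+j^2)^sv_j^2<\infty\}$. $\|\cdot\|_\infty$ is the supremum norm on $\mathrm I$, and $C^k(\mathrm I)$ consists of the $C^k$ functions for which $\|v\|_{C^k}$ is finite. *)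

theory Defs
  imports "HOL-Analysis.Analysis"
begin

abbreviation unit_ival :: "real set" where
  "unit_ival \<equiv> {0<..<1}"

definition weight :: "real \<Rightarrow> real \<Rightarrow> real \<Rightarrow> real" where
  "weight a b x = (1 - x) powr a * x powr b"

(* Szego, Orthogonal Polynomials, (4.3.2).  Unlike the hypergeometric form or the three-term
   recurrence it has no exceptional parameters for a, b > -1; the value at 1 is (n + a) gchoose n. *)
definition jacobi :: "real \<Rightarrow> real \<Rightarrow> nat \<Rightarrow> real \<Rightarrow> real" where
  "jacobi a b n t =
     (\<Sum>m\<le>n. ((real n + a) gchoose (n - m)) * ((real n + b) gchoose m)
            * ((t - 1) / 2) ^ m * ((t + 1) / 2) ^ (n - m))"

definition sjacobi :: "real \<Rightarrow> real \<Rightarrow> nat \<Rightarrow> real \<Rightarrow> real" where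
  "sjacobi a b j x = jacobi a b j (2 * x - 1)"

definition njacobi :: "real \<Rightarrow> real \<Rightarrow> nat \<Rightarrow> real \<Rightarrow> real" where
  "njacobi a b j x =
     sjacobi a b j x / sqrt (LINT y|lebesgue_on unit_ival. weight a b y * (sjacobi a b j y)\<^sup>2)"

(* The elements of L2w and Hs are functions, not classes; values outside (0,1) are irrelevant
   and functions equal almost everywhere on (0,1) represent the same element. *)
definition L2w :: "real \<Rightarrow> real \<Rightarrow> (real \<Rightarrow> real) set" where
  "L2w a b = {v. v \<in> borel_measurable (lebesgue_on unit_ival) \<and>
                 integrable (lebesgue_on unit_ival) (\<lambda>x. weight a b x * (v x)\<^sup>2)}"

definition jcoeff :: "real \<Rightarrow> real \<Rightarrow> (real \<Rightarrow> real) \<Rightarrow> nat \<Rightarrow> real" where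
  "jcoeff a b v j = (LINT x|lebesgue_on unit_ival. weight a b x * v x * njacobi a b j x)"

definition Hs :: "real \<Rightarrow> real \<Rightarrow> real \<Rightarrow> (real \<Rightarrow> real) set" where
  "Hs a b s = {v \<in> L2w a b. summable (\<lambda>j. (1 + (real j)\<^sup>2) powr s * (jcoeff a b v j)\<^sup>2)}"

definition Hs_norm :: "real \<Rightarrow> real \<Rightarrow> real \<Rightarrow> (real \<Rightarrow> real) \<Rightarrow> real" where
  "Hs_norm a b s v = sqrt (\<Sum>j. (1 + (real j)\<^sup>2) powr s * (jcoeff a b v j)\<^sup>2)"

definition sup_norm :: "(real \<Rightarrow> real) \<Rightarrow> real" where
  "sup_norm f = (SUP x\<in>unit_ival. \<bar>f x\<bar>)"

(* The two boundedness conditions say that Ck_norm is finite (a real supremum of an unbounded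
   set would be a junk value).  Values outside (0,1) are irrelevant, as (0,1) is open. *)
definition Ck :: "nat \<Rightarrow> (real \<Rightarrow> real) set" where
  "Ck k = {f. (\<forall>i<k. \<forall>x\<in>unit_ival. (deriv ^^ i) f field_differentiable (at x)) \<and>
              continuous_on unit_ival ((deriv ^^ k) f) \<and>
              bounded (f ` unit_ival) \<and> bounded ((deriv ^^ k) f ` unit_ival)}"

definition Ck_norm :: "nat \<Rightarrow> (real \<Rightarrow> real) \<Rightarrow> real" where
  "Ck_norm k f = sup_norm f + sup_norm ((deriv ^^ k) f)"

(* Functions are identified when they agree on S. *)
definition banach_fun_space ::
    "real set \<Rightarrow> (real \<Rightarrow> real) set \<Rightarrow> ((real \<Rightarrow> real) \<Rightarrow> real) \<Rightarrow> bool" where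
  "banach_fun_space S X N \<longleftrightarrow>
     (\<lambda>x. 0) \<in> X \<and>
     (\<forall>f\<in>X. \<forall>g\<in>X. (\<lambda>x. f x + g x) \<in> X \<and> N (\<lambda>x. f x + g x) \<le> N f + N g) \<and>
     (\<forall>f\<in>X. \<forall>c. (\<lambda>x. c * f x) \<in> X \<and> N (\<lambda>x. c * f x) = \<bar>c\<bar> * N f) \<and>
     (\<forall>f\<in>X. N f \<ge> 0 \<and> (N f = 0 \<longleftrightarrow> (\<forall>x\<in>S. f x = 0))) \<and>
     (\<forall>F. (\<forall>n. F n \<in> X) \<and>
          (\<forall>e>0. \<exists>M. \<forall>m\<ge>M. \<forall>n\<ge>M. N (\<lambda>x. F m x - F n x) < e) \<longrightarrow>
          (\<exists>g\<in>X. (\<lambda>n. N (\<lambda>x. F n x - g x)) \<longlonglongrightarrow> 0))"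

end

theory Submission
  imports Defs
begin

text \<open>
Completeness of \<open>Ck k\<close> rests on the fact that sup norms of a function and of its \<open>k\<close>-th derivative
control all derivatives in between (\<open>Ck_norm_bounds_derivatives\<close>): a function bounded on an
interval has small derivatives somewhere, by the mean value theorem, and the top derivative
controls how fast the lower ones can change.  A Cauchy sequence therefore converges uniformly
with all derivatives up to order \<open>k\<close>.

For the embedding, write \<open>g\<^sub>j\<close> for the normalised Jacobi polynomials.  By Cauchy-Schwarz, the partial
sums of \<open>\<Sum>j. v\<^sub>j * g\<^sub>j\<close> form a Cauchy sequence in \<open>Ck k\<close>, with norm at most a constant times the Sobolev
norm, as soon as the sum of \<open>(1 + j\<^sup>2) powr (- s)\<close> times the square of the \<open>i\<close>-th derivative of \<open>g\<^sub>j\<close> at \<open>x\<close> is bounded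
uniformly in \<open>x\<close>, for \<open>i = 0\<close> and \<open>i = k\<close>
(\<open>jacobi_expansion_bound\<close>).  Sharp sup norm estimates of the single polynomials are avoided:
by a dyadic decomposition (\<open>dyadic_summation\<close>) it is enough to know the growth in \<open>n\<close> of the
Christoffel kernel, the sum of these squares over \<open>j \<le> n\<close>, and by duality this is the best constant in an inequality
bounding the square of the \<open>i\<close>-th derivative at \<open>x\<close> of a polynomial of degree at most \<open>n\<close> by its squared
weighted \<open>L\<^sup>2\<close> norm.

That inequality has two ingredients.  The Jacobi differential equation (\<open>jacobi_op_jpoly\<close>) and
integration by parts show that the derivatives \<open>g\<^sub>j'\<close> are orthogonal for the weight with both exponents
raised by one, with squared norms \<open>j * (j + a + b + 1)\<close>; so one derivative costs a factor \<open>n\<close> when the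
exponents are raised as well (\<open>bernstein_L2\<close>).  Orthogonality of the \<open>g\<^sub>j\<close> themselves comes from the
same equation.  What is left is the case without derivatives (\<open>nikolskii\<close>).  For the Chebyshev weight
the substitution \<open>x = (1 - cos \<theta>) / 2\<close> turns it into a trivial statement on cosine sums; any other
weight is bounded below by a power of \<open>n\<close> times the Chebyshev weight, except for angles closer to
\<open>0\<close> or \<open>\<pi>\<close> than a small multiple of \<open>1 / n\<close>, and a cosine sum of order \<open>n\<close> keeps a fixed part of its \<open>L\<^sup>2\<close> norm when these are dropped.

Finally the limit \<open>w\<close> of the partial sums has the same Jacobi coefficients as \<open>v\<close>, so all moments
of \<open>weight * (w - v)\<close> vanish and \<open>w = v\<close> almost everywhere (\<open>AE_0_of_vanishing_moments\<close>).
\<close>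

section \<open>The normed space of k times differentiable functions\<close>

lemma sup_norm_upper:
  assumes "bounded (f ` unit_ival)" "x \<in> unit_ival"
  shows "\<bar>f x\<bar> \<le> sup_norm f"
proof -
  have "bdd_above ((\<lambda>x. \<bar>f x\<bar>) ` unit_ival)"
    using assms(1) unfolding bounded_real bdd_above_def by auto
  then show ?thesis
    unfolding sup_norm_def using assms(2) by (rule cSUP_upper[rotated])
qed

lemma sup_norm_least:
  assumes "\<And>x. x \<in> unit_ival \<Longrightarrow> \<bar>f x\<bar> \<le> M"
  shows "sup_norm f \<le> M"
  unfolding sup_norm_def by (rule cSUP_least) (use assms in auto)

lemma sup_norm_nonneg: "bounded (f ` unit_ival) \<Longrightarrow> 0 \<le> sup_norm f"
  using sup_norm_upper[of f "1/2"] by auto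

lemma sup_norm_cong:
  assumes "\<And>x. x \<in> unit_ival \<Longrightarrow> f x = g x"
  shows "sup_norm f = sup_norm g"
  unfolding sup_norm_def using assms by simp

lemma sup_norm_eq_0_iff:
  assumes "bounded (f ` unit_ival)"
  shows "sup_norm f = 0 \<longleftrightarrow> (\<forall>x\<in>unit_ival. f x = 0)"
proof
  assume "sup_norm f = 0"
  then show "\<forall>x\<in>unit_ival. f x = 0"
    using sup_norm_upper[OF assms] by force
next
  assume "\<forall>x\<in>unit_ival. f x = 0"
  then have "sup_norm f \<le> 0" by (intro sup_norm_least) auto
  then show "sup_norm f = 0" using sup_norm_nonneg[OF assms] by simp
qed

lemma sup_norm_triangle:
  assumes "bounded (f ` unit_ival)" "bounded (g ` unit_ival)"
  shows "sup_norm (\<lambda>x. f x + g x) \<le> sup_norm f + sup_norm g"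
  by (rule sup_norm_least)
    (use sup_norm_upper[OF assms(1)] sup_norm_upper[OF assms(2)] abs_triangle_ineq
      in \<open>fastforce intro: order_trans add_mono\<close>)

lemma sup_norm_scale:
  assumes "bounded (f ` unit_ival)"
  shows "sup_norm (\<lambda>x. c * f x) = \<bar>c\<bar> * sup_norm f"
proof (rule antisym)
  show "sup_norm (\<lambda>x. c * f x) \<le> \<bar>c\<bar> * sup_norm f"
    using sup_norm_upper[OF assms]
    by (intro sup_norm_least) (simp add: abs_mult mult_left_mono)
  show "\<bar>c\<bar> * sup_norm f \<le> sup_norm (\<lambda>x. c * f x)"
  proof (cases "c = 0")
    case True
    then show ?thesis unfolding sup_norm_def by simp
  next
    case False
    have b: "bounded ((\<lambda>x. c * f x) ` unit_ival)"
      using bounded_scaling[OF assms, of c] by (simp add: image_image)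
    have "sup_norm f \<le> sup_norm (\<lambda>x. c * f x) / \<bar>c\<bar>"
      using sup_norm_upper[OF b] False
      by (intro sup_norm_least) (simp add: field_simps abs_mult)
    then show ?thesis using False by (simp add: field_simps)
  qed
qed

text \<open>
Membership in \<open>Ck\<close> speaks of iterates of \<open>deriv\<close>, which is awkward to establish directly.  A chain
is an explicit sequence of candidates for the derivatives of \<open>D 0\<close>, in which each step is a genuine
derivative.
\<close>

definition derivative_chain :: "nat \<Rightarrow> real set \<Rightarrow> (nat \<Rightarrow> real \<Rightarrow> real) \<Rightarrow> bool" where
  "derivative_chain k S D \<longleftrightarrow> (\<forall>i<k. \<forall>x\<in>S. (D i has_field_derivative D (Suc i) x) (at x))"

lemma derivative_chain_mono:
  "derivative_chain k S D \<Longrightarrow> j \<le> k \<Longrightarrow> T \<subseteq> S \<Longrightarrow> derivative_chain j T D"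
  unfolding derivative_chain_def by auto

text \<open>
A derivative depends only on the germ of the function, so on an open set the candidates are the
iterated derivatives of any \<open>f\<close> that agrees with \<open>D 0\<close> there.
\<close>

lemma higher_deriv_eq_chain:
  assumes "open S" "derivative_chain k S D" "\<And>x. x \<in> S \<Longrightarrow> f x = D 0 x"
    and "i \<le> k" "x \<in> S"
  shows "(deriv ^^ i) f x = D i x"
  using assms(4,5)
proof (induction i arbitrary: x)
  case 0
  then show ?case using assms(3) by simp
next
  case (Suc i)
  have "eventually (\<lambda>y. (deriv ^^ i) f y = D i y) (nhds x)"
    using Suc assms(1) by (auto simp: eventually_nhds)
  then have "(deriv ^^ Suc i) f x = deriv (D i) x"
    by (simp add: deriv_cong_ev)
  also have "\<dots> = D (Suc i) x"
    using assms(2) Suc.prems by (auto simp: derivative_chain_def intro!: DERIV_imp_deriv)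
  finally show ?case .
qed

lemma Ck_of_chain:
  assumes D: "derivative_chain k unit_ival D" "\<And>x. x \<in> unit_ival \<Longrightarrow> f x = D 0 x"
    and cont: "continuous_on unit_ival (D k)"
    and bdd: "bounded (D 0 ` unit_ival)" "bounded (D k ` unit_ival)"
  shows "f \<in> Ck k" "Ck_norm k f = sup_norm (D 0) + sup_norm (D k)"
proof -
  have eq: "(deriv ^^ i) f x = D i x" if "i \<le> k" "x \<in> unit_ival" for i x
    using higher_deriv_eq_chain[OF _ D that] by simp
  have "(deriv ^^ i) f field_differentiable (at x)" if "i < k" "x \<in> unit_ival" for i x
  proof -
    have "eventually (\<lambda>y. y \<in> unit_ival) (nhds x)"
      using that eventually_nhds_in_open[of unit_ival x] by simp
    then have "eventually (\<lambda>y. (deriv ^^ i) f y = D i y) (nhds x)"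
      by eventually_elim (use that eq in auto)
    moreover have "(D i has_field_derivative D (Suc i) x) (at x)"
      using D that by (auto simp: derivative_chain_def)
    ultimately have "((deriv ^^ i) f has_field_derivative D (Suc i) x) (at x)"
      using DERIV_cong_ev[OF refl _ refl] by blast
    then show ?thesis by (auto simp: field_differentiable_def)
  qed
  moreover have "continuous_on unit_ival ((deriv ^^ k) f)"
    using cont by (subst continuous_on_cong[OF refl eq]) auto
  moreover have "f ` unit_ival = D 0 ` unit_ival" "(deriv ^^ k) f ` unit_ival = D k ` unit_ival"
    using D(2) eq[of k] by (auto intro!: image_cong)
  ultimately show "f \<in> Ck k" using bdd unfolding Ck_def by auto
  show "Ck_norm k f = sup_norm (D 0) + sup_norm (D k)"
    unfolding Ck_norm_def using D(2) eq[of k] by (auto intro!: arg_cong2[where f="(+)"] sup_norm_cong)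
qed

lemma Ck_chain: "f \<in> Ck k \<Longrightarrow> derivative_chain k unit_ival (\<lambda>i. (deriv ^^ i) f)"
  unfolding Ck_def derivative_chain_def
  by (auto simp: field_differentiable_derivI)

lemma Ck_bounded:
  assumes "f \<in> Ck k"
  shows "bounded (f ` unit_ival)" "bounded ((deriv ^^ k) f ` unit_ival)"
  using assms by (auto simp: Ck_def)

lemma Ck_add:
  assumes "f \<in> Ck k" "g \<in> Ck k"
  shows "(\<lambda>x. f x + g x) \<in> Ck k" "Ck_norm k (\<lambda>x. f x + g x) \<le> Ck_norm k f + Ck_norm k g"
    "x \<in> unit_ival \<Longrightarrow> i \<le> k \<Longrightarrow>
      (deriv ^^ i) (\<lambda>x. f x + g x) x = (deriv ^^ i) f x + (deriv ^^ i) g x"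
proof -
  let ?D = "\<lambda>i x. (deriv ^^ i) f x + (deriv ^^ i) g x"
  have D: "derivative_chain k unit_ival ?D"
    using Ck_chain[OF assms(1)] Ck_chain[OF assms(2)] unfolding derivative_chain_def
    by (auto intro!: DERIV_add)
  have C: "continuous_on unit_ival (?D k)"
    using assms by (auto simp: Ck_def intro!: continuous_intros)
  have B: "bounded (?D 0 ` unit_ival)" "bounded (?D k ` unit_ival)"
    using Ck_bounded[OF assms(1)] Ck_bounded[OF assms(2)] by (auto intro!: bounded_plus_comp)
  show "(\<lambda>x. f x + g x) \<in> Ck k" by (rule Ck_of_chain[OF D _ C B]) simp
  have "Ck_norm k (\<lambda>x. f x + g x) = sup_norm (?D 0) + sup_norm (?D k)"
    by (rule Ck_of_chain[OF D _ C B]) simp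
  also have "\<dots> \<le> (sup_norm f + sup_norm g) + (sup_norm ((deriv ^^ k) f) + sup_norm ((deriv ^^ k) g))"
    using Ck_bounded[OF assms(1)] Ck_bounded[OF assms(2)] by (simp add: add_mono sup_norm_triangle)
  finally show "Ck_norm k (\<lambda>x. f x + g x) \<le> Ck_norm k f + Ck_norm k g"
    by (simp add: Ck_norm_def)
  show "(deriv ^^ i) (\<lambda>x. f x + g x) x = ?D i x" if "x \<in> unit_ival" "i \<le> k"
    by (rule higher_deriv_eq_chain[OF _ D]) (use that in auto)
qed

lemma Ck_scale:
  assumes "f \<in> Ck k"
  shows "(\<lambda>x. c * f x) \<in> Ck k" "Ck_norm k (\<lambda>x. c * f x) = \<bar>c\<bar> * Ck_norm k f"
    "x \<in> unit_ival \<Longrightarrow> i \<le> k \<Longrightarrow> (deriv ^^ i) (\<lambda>x. c * f x) x = c * (deriv ^^ i) f x"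
proof -
  let ?D = "\<lambda>i x. c * (deriv ^^ i) f x"
  have D: "derivative_chain k unit_ival ?D"
    using Ck_chain[OF assms(1)] unfolding derivative_chain_def
    by (auto intro!: DERIV_cmult)
  have C: "continuous_on unit_ival (?D k)"
    using assms by (auto simp: Ck_def intro!: continuous_intros)
  have B: "bounded (?D 0 ` unit_ival)" "bounded (?D k ` unit_ival)"
    using bounded_scaling[OF Ck_bounded(1)[OF assms(1)], of c]
      bounded_scaling[OF Ck_bounded(2)[OF assms(1)], of c] by (auto simp: image_image)
  show "(\<lambda>x. c * f x) \<in> Ck k" by (rule Ck_of_chain[OF D _ C B]) simp
  have "Ck_norm k (\<lambda>x. c * f x) = sup_norm (?D 0) + sup_norm (?D k)"
    by (rule Ck_of_chain[OF D _ C B]) simp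
  also have "\<dots> = \<bar>c\<bar> * Ck_norm k f"
    using Ck_bounded[OF assms(1)] by (simp add: sup_norm_scale Ck_norm_def ring_distribs)
  finally show "Ck_norm k (\<lambda>x. c * f x) = \<bar>c\<bar> * Ck_norm k f" .
  show "(deriv ^^ i) (\<lambda>x. c * f x) x = ?D i x" if "x \<in> unit_ival" "i \<le> k"
    by (rule higher_deriv_eq_chain[OF _ D]) (use that in auto)
qed

lemma Ck_diff:
  assumes "f \<in> Ck k" "g \<in> Ck k"
  shows "(\<lambda>x. f x - g x) \<in> Ck k"
    "x \<in> unit_ival \<Longrightarrow> i \<le> k \<Longrightarrow>
      (deriv ^^ i) (\<lambda>x. f x - g x) x = (deriv ^^ i) f x - (deriv ^^ i) g x"
  using Ck_add[OF assms(1) Ck_scale(1)[OF assms(2), of "-1"]]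
    Ck_scale(3)[OF assms(2), of _ _ "-1"] by auto

lemma Ck_norm_nonneg: "f \<in> Ck k \<Longrightarrow> 0 \<le> Ck_norm k f"
  using Ck_bounded[of f k] by (simp add: Ck_norm_def sup_norm_nonneg)

text \<open>
By induction there are points in the left and in the right third of the interval at which the
\<open>j\<close>-th derivative is small.  They are at least a third of the length apart, so the mean value theorem
gives a point between them at which the next derivative is small.
\<close>

lemma derivative_small_somewhere:
  fixes u v :: real
  assumes "u < v"
  shows "\<exists>C\<ge>0. \<forall>D M. derivative_chain j {u<..<v} D \<and> (\<forall>x\<in>{u<..<v}. \<bar>D 0 x\<bar> \<le> M) \<longrightarrow>
           (\<exists>\<xi>\<in>{u<..<v}. \<bar>D j \<xi>\<bar> \<le> C * M)"
  using assms
proof (induction j arbitrary: u v)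
  case 0
  have "(u + v) / 2 \<in> {u<..<v}" using 0 by simp
  then show ?case by (intro exI[of _ 1] conjI) (simp, fastforce)
next
  case (Suc j)
  define h where "h = (v - u) / 3"
  have h: "h > 0" "u + h < v - h" "v - h - (u + h) = h" "u < v - h" "u + h < v"
    using Suc.prems by (auto simp: h_def field_simps)
  obtain C1 where C1: "C1 \<ge> 0" "\<And>D M. derivative_chain j {u<..<u+h} D \<Longrightarrow>
      (\<And>x. x \<in> {u<..<u+h} \<Longrightarrow> \<bar>D 0 x\<bar> \<le> M) \<Longrightarrow> \<exists>\<xi>\<in>{u<..<u+h}. \<bar>D j \<xi>\<bar> \<le> C1 * M"
    using Suc.IH[of u "u + h"] h by auto
  obtain C2 where C2: "C2 \<ge> 0" "\<And>D M. derivative_chain j {v-h<..<v} D \<Longrightarrow>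
      (\<And>x. x \<in> {v-h<..<v} \<Longrightarrow> \<bar>D 0 x\<bar> \<le> M) \<Longrightarrow> \<exists>\<xi>\<in>{v-h<..<v}. \<bar>D j \<xi>\<bar> \<le> C2 * M"
    using Suc.IH[of "v - h" v] h by auto
  show ?case
  proof (intro exI[of _ "(C1 + C2) / h"] conjI allI impI)
    show "(C1 + C2) / h \<ge> 0" using h C1 C2 by simp
    fix D :: "nat \<Rightarrow> real \<Rightarrow> real" and M
    assume DM: "derivative_chain (Suc j) {u<..<v} D \<and> (\<forall>x\<in>{u<..<v}. \<bar>D 0 x\<bar> \<le> M)"
    obtain y where y: "y \<in> {u<..<u+h}" "\<bar>D j y\<bar> \<le> C1 * M"
      using C1(2)[of D M] DM h derivative_chain_mono[of "Suc j" "{u<..<v}" D j "{u<..<u+h}"]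
      by fastforce
    obtain z where z: "z \<in> {v-h<..<v}" "\<bar>D j z\<bar> \<le> C2 * M"
      using C2(2)[of D M] DM h derivative_chain_mono[of "Suc j" "{u<..<v}" D j "{v-h<..<v}"]
      by fastforce
    have yz: "y < z" "h \<le> z - y" using y z h by auto
    have "\<exists>\<xi>. y < \<xi> \<and> \<xi> < z \<and> D j z - D j y = (z - y) * D (Suc j) \<xi>"
      by (rule MVT2[OF yz(1)]) (use DM y z in \<open>auto simp: derivative_chain_def\<close>)
    then obtain \<xi> where \<xi>: "y < \<xi>" "\<xi> < z" "D j z - D j y = (z - y) * D (Suc j) \<xi>" by blast
    have "h * \<bar>D (Suc j) \<xi>\<bar> \<le> (z - y) * \<bar>D (Suc j) \<xi>\<bar>"
      using yz by (intro mult_right_mono) auto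
    also have "\<dots> = \<bar>D j z - D j y\<bar>" using \<xi> yz by (simp add: abs_mult)
    also have "\<dots> \<le> (C1 + C2) * M" using y z by (simp add: ring_distribs)
    finally have "\<bar>D (Suc j) \<xi>\<bar> \<le> (C1 + C2) / h * M" using h by (simp add: field_simps)
    moreover have "\<xi> \<in> {u<..<v}" using \<xi> y z by auto
    ultimately show "\<exists>\<xi>\<in>{u<..<v}. \<bar>D (Suc j) \<xi>\<bar> \<le> (C1 + C2) / h * M" by blast
  qed
qed

text \<open>
Downwards from \<open>k\<close>: the \<open>j\<close>-th derivative is small at one point, and the bound on the next one limits its
variation over the whole interval.
\<close>

lemma intermediate_derivative_bound:
  assumes "j \<le> k"
  shows "\<exists>C\<ge>0. \<forall>D M. derivative_chain k {0<..<1} D \<and> (\<forall>x\<in>{0<..<1}. \<bar>D 0 x\<bar> \<le> M) \<and>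
           (\<forall>x\<in>{0<..<1}. \<bar>D k x\<bar> \<le> M) \<longrightarrow> (\<forall>x\<in>{0<..<1}. \<bar>D j x\<bar> \<le> C * M)"
  using assms
proof (induction rule: inc_induct)
  case base
  show ?case by (intro exI[of _ 1]) auto
next
  case (step j)
  from step.IH obtain C where C: "C \<ge> 0" "\<And>D M x. derivative_chain k {0<..<1} D \<Longrightarrow>
      \<forall>x\<in>{0<..<1}. \<bar>D 0 x\<bar> \<le> M \<Longrightarrow> \<forall>x\<in>{0<..<1}. \<bar>D k x\<bar> \<le> M \<Longrightarrow>
      x \<in> {0<..<1} \<Longrightarrow> \<bar>D (Suc j) x\<bar> \<le> C * M"
    by blast
  obtain C0 where C0: "C0 \<ge> 0" "\<And>D M. derivative_chain j {0<..<1} D \<Longrightarrow>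
      \<forall>x\<in>{0<..<1}. \<bar>D 0 x\<bar> \<le> M \<Longrightarrow> \<exists>\<xi>\<in>{0<..<1}. \<bar>D j \<xi>\<bar> \<le> C0 * M"
    using derivative_small_somewhere[of 0 1 j] by auto
  show ?case
  proof (intro exI[of _ "C0 + C"] conjI allI impI ballI)
    show "C0 + C \<ge> 0" using C0 C by simp
    fix D :: "nat \<Rightarrow> real \<Rightarrow> real" and M x :: real
    assume x: "x \<in> {0<..<1}" and DM: "derivative_chain k {0<..<1} D \<and>
      (\<forall>x\<in>{0<..<1}. \<bar>D 0 x\<bar> \<le> M) \<and> (\<forall>x\<in>{0<..<1}. \<bar>D k x\<bar> \<le> M)"
    have "derivative_chain j {0<..<1} D"
      using DM step.hyps by (auto intro: derivative_chain_mono)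
    then obtain \<xi> where \<xi>: "\<xi> \<in> {0<..<1}" "\<bar>D j \<xi>\<bar> \<le> C0 * M" using C0 DM by blast
    have "norm (D j x - D j \<xi>) \<le> C * M * norm (x - \<xi>)"
    proof (rule field_differentiable_bound[of "{0<..<1}"])
      show "(D j has_field_derivative D (Suc j) z) (at z within {0<..<1})"
        if "z \<in> {0<..<1}" for z
        using DM that step.hyps by (auto simp: derivative_chain_def intro: has_field_derivative_at_within)
      show "norm (D (Suc j) z) \<le> C * M" if "z \<in> {0<..<1}" for z
        using C(2)[of D M z] DM that by auto
    qed (use x \<xi> in auto)
    also have "\<dots> \<le> C * M * 1"
    proof (rule mult_left_mono)
      have "0 \<le> M" using DM x by fastforce
      then show "0 \<le> C * M" using C by simp
    qed (use x \<xi> in auto)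
    finally show "\<bar>D j x\<bar> \<le> (C0 + C) * M"
      using \<xi> by (simp add: ring_distribs)
  qed
qed

lemma Ck_norm_bounds_derivatives:
  "\<exists>C\<ge>0. \<forall>f\<in>Ck k. \<forall>i\<le>k. \<forall>x\<in>unit_ival. \<bar>(deriv ^^ i) f x\<bar> \<le> C * Ck_norm k f"
proof -
  have ex: "\<forall>i\<in>{..k}. \<exists>C\<ge>0. \<forall>f\<in>Ck k. \<forall>x\<in>unit_ival. \<bar>(deriv ^^ i) f x\<bar> \<le> C * Ck_norm k f"
  proof
    fix i assume "i \<in> {..k}"
    then obtain C where C: "C \<ge> 0" "\<And>D M x. derivative_chain k {0<..<1} D \<Longrightarrow>
      \<forall>x\<in>{0<..<1}. \<bar>D 0 x\<bar> \<le> M \<Longrightarrow> \<forall>x\<in>{0<..<1}. \<bar>D k x\<bar> \<le> M \<Longrightarrow>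
      x \<in> {0<..<1} \<Longrightarrow> \<bar>D i x\<bar> \<le> C * M"
      using intermediate_derivative_bound[of i k] by auto
    have "\<bar>(deriv ^^ i) f x\<bar> \<le> C * Ck_norm k f" if f: "f \<in> Ck k" and x: "x \<in> unit_ival" for f x
    proof (rule C(2)[OF Ck_chain[OF f] _ _ x])
      note b = Ck_bounded[OF f]
      show "\<forall>x\<in>unit_ival. \<bar>(deriv ^^ 0) f x\<bar> \<le> Ck_norm k f"
        using sup_norm_upper[OF b(1)] sup_norm_nonneg[OF b(2)] by (fastforce simp: Ck_norm_def)
      show "\<forall>x\<in>unit_ival. \<bar>(deriv ^^ k) f x\<bar> \<le> Ck_norm k f"
        using sup_norm_upper[OF b(2)] sup_norm_nonneg[OF b(1)] by (fastforce simp: Ck_norm_def)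
    qed
    then show "\<exists>C\<ge>0. \<forall>f\<in>Ck k. \<forall>x\<in>unit_ival. \<bar>(deriv ^^ i) f x\<bar> \<le> C * Ck_norm k f"
      using C(1) by blast
  qed
  obtain C where C: "\<And>i. i \<le> k \<Longrightarrow> C i \<ge> 0"
    "\<And>i f x. i \<le> k \<Longrightarrow> f \<in> Ck k \<Longrightarrow> x \<in> unit_ival \<Longrightarrow> \<bar>(deriv ^^ i) f x\<bar> \<le> C i * Ck_norm k f"
    using bchoice[OF ex] by (metis atMost_iff)
  have "\<bar>(deriv ^^ i) f x\<bar> \<le> sum C {..k} * Ck_norm k f"
    if "f \<in> Ck k" "i \<le> k" "x \<in> unit_ival" for f i x
  proof -
    have "C i \<le> sum C {..k}" using that C(1) by (intro member_le_sum) auto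
    then have "C i * Ck_norm k f \<le> sum C {..k} * Ck_norm k f"
      using Ck_norm_nonneg that by (intro mult_right_mono) auto
    then show ?thesis using C(2)[OF that(2,1,3)] by linarith
  qed
  moreover have "sum C {..k} \<ge> 0" using C(1) by (intro sum_nonneg) auto
  ultimately show ?thesis by blast
qed

lemma bounded_uniform_limit:
  fixes F :: "nat \<Rightarrow> real \<Rightarrow> real"
  assumes lim: "uniform_limit S F g sequentially" and b: "\<And>n. bounded (F n ` S)"
  shows "bounded (g ` S)"
proof -
  from uniform_limitD[OF lim, of 1] obtain n where n: "\<forall>x\<in>S. dist (F n x) (g x) < 1"
    by (auto simp: eventually_sequentially)
  from b[of n] obtain B where B: "\<forall>x\<in>S. \<bar>F n x\<bar> \<le> B" by (auto simp: bounded_real)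
  have "\<bar>g x\<bar> \<le> B + 1" if "x \<in> S" for x
    using B n that by (force simp: dist_real_def)
  then show ?thesis by (auto simp: bounded_real)
qed

lemma sup_norm_tendsto_0:
  assumes lim: "uniform_limit unit_ival F g sequentially"
    and b: "\<And>n. bounded ((\<lambda>x. F n x - g x) ` unit_ival)"
  shows "(\<lambda>n. sup_norm (\<lambda>x. F n x - g x)) \<longlonglongrightarrow> 0"
proof (rule tendstoI)
  fix e :: real assume "e > 0"
  then have "eventually (\<lambda>n. \<forall>x\<in>unit_ival. dist (F n x) (g x) < e / 2) sequentially"
    using uniform_limitD[OF lim, of "e / 2"] by simp
  then show "eventually (\<lambda>n. dist (sup_norm (\<lambda>x. F n x - g x)) 0 < e) sequentially"
  proof eventually_elim
    case (elim n)
    have "sup_norm (\<lambda>x. F n x - g x) \<le> e / 2"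
      by (rule sup_norm_least) (use elim in \<open>auto simp: dist_real_def less_imp_le\<close>)
    then show ?case using sup_norm_nonneg[OF b[of n]] \<open>e > 0\<close> by auto
  qed
qed

text \<open>
All derivatives up to order \<open>k\<close> are uniformly Cauchy, because the norm controls them.  Their limits form
a derivative chain.
\<close>

lemma Ck_complete:
  assumes F: "\<And>n. F n \<in> Ck k"
    and cauchy: "\<And>e. e > 0 \<Longrightarrow> \<exists>M. \<forall>m\<ge>M. \<forall>n\<ge>M. Ck_norm k (\<lambda>x. F m x - F n x) < e"
  shows "\<exists>g\<in>Ck k. (\<lambda>n. Ck_norm k (\<lambda>x. F n x - g x)) \<longlonglongrightarrow> 0"
proof -
  obtain C where C: "C \<ge> 0"
    "\<And>f i x. f \<in> Ck k \<Longrightarrow> i \<le> k \<Longrightarrow> x \<in> unit_ival \<Longrightarrow> \<bar>(deriv ^^ i) f x\<bar> \<le> C * Ck_norm k f"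
    using Ck_norm_bounds_derivatives[of k] by blast
  have unif: "\<exists>G. uniform_limit unit_ival (\<lambda>n. (deriv ^^ i) (F n)) G sequentially"
    if i: "i \<le> k" for i
  proof -
    have "uniformly_convergent_on unit_ival (\<lambda>n. (deriv ^^ i) (F n))"
    proof (rule Cauchy_uniformly_convergent, unfold uniformly_Cauchy_on_def, intro allI impI)
      fix e :: real assume "e > 0"
      then have "e / (C + 1) > 0" using C(1) by simp
      then obtain M where M: "\<And>m n. m \<ge> M \<Longrightarrow> n \<ge> M \<Longrightarrow> Ck_norm k (\<lambda>x. F m x - F n x) < e / (C + 1)"
        using cauchy by blast
      show "\<exists>M. \<forall>x\<in>unit_ival. \<forall>m\<ge>M. \<forall>n\<ge>M. dist ((deriv ^^ i) (F m) x) ((deriv ^^ i) (F n) x) < e"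
      proof (intro exI[of _ M] ballI allI impI)
        fix x m n assume x: "x \<in> unit_ival" and mn: "m \<ge> M" "n \<ge> M"
        let ?d = "\<lambda>x. F m x - F n x"
        have d: "?d \<in> Ck k" by (rule Ck_diff[OF F F])
        have "dist ((deriv ^^ i) (F m) x) ((deriv ^^ i) (F n) x) = \<bar>(deriv ^^ i) ?d x\<bar>"
          using Ck_diff(2)[OF F F x i] by (simp add: dist_real_def)
        also have "\<dots> \<le> C * Ck_norm k ?d" by (rule C(2)[OF d i x])
        also have "\<dots> \<le> (C + 1) * Ck_norm k ?d"
          using Ck_norm_nonneg[OF d] by (simp add: mult_right_mono)
        also have "\<dots> < e" using M[OF mn] C(1) by (simp add: field_simps)
        finally show "dist ((deriv ^^ i) (F m) x) ((deriv ^^ i) (F n) x) < e" .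
      qed
    qed
    then show ?thesis by (auto simp: uniformly_convergent_on_def)
  qed
  define G where "G i = (SOME G. uniform_limit unit_ival (\<lambda>n. (deriv ^^ i) (F n)) G sequentially)" for i
  have G: "uniform_limit unit_ival (\<lambda>n. (deriv ^^ i) (F n)) (G i) sequentially" if "i \<le> k" for i
    unfolding G_def using someI_ex[OF unif[OF that]] .
  have chain: "derivative_chain k unit_ival G"
    unfolding derivative_chain_def
  proof (intro allI impI ballI)
    fix i x assume i: "i < k" and x: "x \<in> unit_ival"
    have "\<exists>g. \<forall>x\<in>unit_ival. (\<lambda>n. (deriv ^^ i) (F n) x) \<longlonglongrightarrow> g x \<and>
        (g has_derivative (\<lambda>h. G (Suc i) x * h)) (at x within unit_ival)"
    proof (rule has_derivative_sequence[where f' = "\<lambda>n x h. (deriv ^^ Suc i) (F n) x * h"])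
      show "((deriv ^^ i) (F n) has_derivative (\<lambda>h. (deriv ^^ Suc i) (F n) x * h)) (at x within unit_ival)"
        if "x \<in> unit_ival" for n x
        using Ck_chain[OF F[of n]] that i has_field_derivative_at_within
        unfolding derivative_chain_def has_field_derivative_def[symmetric] by blast
      show "\<forall>\<^sub>F n in sequentially. \<forall>x\<in>unit_ival. \<forall>h.
          norm ((deriv ^^ Suc i) (F n) x * h - G (Suc i) x * h) \<le> e * norm h" if "e > 0" for e :: real
      proof -
        have "\<forall>\<^sub>F n in sequentially. \<forall>x\<in>unit_ival. dist ((deriv ^^ Suc i) (F n) x) (G (Suc i) x) < e"
          using G[of "Suc i"] i that by (auto dest: uniform_limitD)
        then show ?thesis
        proof eventually_elim
          case (elim n)
          show ?case
          proof (intro ballI allI)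
            fix x h :: real assume "x \<in> unit_ival"
            then have "\<bar>(deriv ^^ Suc i) (F n) x - G (Suc i) x\<bar> \<le> e"
              using elim by (auto simp: dist_real_def intro: less_imp_le simp del: funpow.simps)
            then show "norm ((deriv ^^ Suc i) (F n) x * h - G (Suc i) x * h) \<le> e * norm h"
              by (simp add: left_diff_distrib[symmetric] abs_mult mult_right_mono del: funpow.simps)
          qed
        qed
      qed
      show "(\<lambda>n. (deriv ^^ i) (F n) x) \<longlonglongrightarrow> G i x"
        using tendsto_uniform_limitI[OF G x] i by simp
    qed (use x in auto)
    then obtain g where g: "\<And>x. x \<in> unit_ival \<Longrightarrow> (\<lambda>n. (deriv ^^ i) (F n) x) \<longlonglongrightarrow> g x"
      "\<And>x. x \<in> unit_ival \<Longrightarrow> (g has_field_derivative G (Suc i) x) (at x within unit_ival)"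
      unfolding has_field_derivative_def by blast
    have eq: "g y = G i y" if "y \<in> unit_ival" for y
      using LIMSEQ_unique[OF g(1)[OF that] tendsto_uniform_limitI[OF G that]] i by simp
    have "(g has_field_derivative G (Suc i) x) (at x)"
      using g(2)[OF x] x at_within_open[of x unit_ival] by simp
    then show "(G i has_field_derivative G (Suc i) x) (at x)"
      by (rule has_field_derivative_transform_within_open[of _ _ _ unit_ival]) (use x eq in auto)
  qed
  have cont: "continuous_on unit_ival (G k)"
    using F by (intro uniform_limit_theorem[OF _ G]) (auto simp: Ck_def)
  have bdd: "bounded (G 0 ` unit_ival)" "bounded (G k ` unit_ival)"
    using Ck_bounded[OF F] by (auto intro!: bounded_uniform_limit[OF G])
  have G0: "G 0 \<in> Ck k" by (rule Ck_of_chain[OF chain _ cont bdd]) simp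
  have "Ck_norm k (\<lambda>x. F n x - G 0 x) =
      sup_norm (\<lambda>x. F n x - G 0 x) + sup_norm (\<lambda>x. (deriv ^^ k) (F n) x - G k x)" for n
  proof -
    have "(deriv ^^ k) (\<lambda>x. F n x - G 0 x) x = (deriv ^^ k) (F n) x - G k x" if x: "x \<in> unit_ival" for x
      using Ck_diff(2)[OF F G0 x order_refl] higher_deriv_eq_chain[OF _ chain _ order_refl x, of "G 0"]
      by simp
    then have "sup_norm ((deriv ^^ k) (\<lambda>x. F n x - G 0 x)) =
        sup_norm (\<lambda>x. (deriv ^^ k) (F n) x - G k x)"
      by (rule sup_norm_cong)
    then show ?thesis by (simp add: Ck_norm_def)
  qed
  moreover have "(\<lambda>n. sup_norm (\<lambda>x. F n x - G 0 x)) \<longlonglongrightarrow> 0"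
    using G[of 0] bdd(1) Ck_bounded(1)[OF F]
    by (intro sup_norm_tendsto_0 bounded_minus_comp) auto
  moreover have "(\<lambda>n. sup_norm (\<lambda>x. (deriv ^^ k) (F n) x - G k x)) \<longlonglongrightarrow> 0"
    using G[of k] bdd(2) Ck_bounded(2)[OF F]
    by (intro sup_norm_tendsto_0 bounded_minus_comp) auto
  ultimately have "(\<lambda>n. Ck_norm k (\<lambda>x. F n x - G 0 x)) \<longlonglongrightarrow> 0"
    using tendsto_add[of _ 0 sequentially _ 0] by simp
  with G0 show ?thesis by blast
qed

lemma Ck_zero: "(\<lambda>x. 0) \<in> Ck k"
  by (rule Ck_of_chain(1)[of _ "\<lambda>i x. 0"]) (auto simp: derivative_chain_def bounded_real)

lemma Ck_norm_eq_0_iff: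
  assumes "f \<in> Ck k"
  shows "Ck_norm k f = 0 \<longleftrightarrow> (\<forall>x\<in>unit_ival. f x = 0)"
proof
  note b = Ck_bounded[OF assms]
  assume "Ck_norm k f = 0"
  then have "sup_norm f = 0"
    using sup_norm_nonneg[OF b(1)] sup_norm_nonneg[OF b(2)] by (simp add: Ck_norm_def)
  then show "\<forall>x\<in>unit_ival. f x = 0" using sup_norm_eq_0_iff[OF b(1)] by simp
next
  assume 0: "\<forall>x\<in>unit_ival. f x = 0"
  have "Ck_norm k f = sup_norm (\<lambda>x. 0) + sup_norm (\<lambda>x. 0)"
    by (rule Ck_of_chain(2)[of _ "\<lambda>i x. 0"])
      (use 0 in \<open>auto simp: derivative_chain_def bounded_real\<close>)
  then show "Ck_norm k f = 0" by (simp add: sup_norm_def)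
qed

lemma Ck_banach: "banach_fun_space unit_ival (Ck k) (Ck_norm k)"
  unfolding banach_fun_space_def
  using Ck_zero Ck_add(1,2) Ck_scale(1,2) Ck_norm_nonneg Ck_norm_eq_0_iff
  by (auto intro: Ck_complete)

section \<open>Weighted integrals of polynomials\<close>

lemma weight_pos: "x \<in> unit_ival \<Longrightarrow> 0 < weight a b x"
  by (simp add: weight_def)

lemma weight_nonneg: "0 \<le> weight a b x"
  by (simp add: weight_def)

lemma weight_Suc: "x \<in> unit_ival \<Longrightarrow> weight (a + 1) (b + 1) x = weight a b x * (x * (1 - x))"
  by (simp add: weight_def powr_add)

text \<open>
The total mass is a value of the Beta function.
\<close>

lemma integrable_weight:
  assumes "a > -1" "b > -1"
  shows "integrable (lebesgue_on unit_ival) (weight a b)"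
proof -
  have "((\<lambda>t. t powr b * (1 - t) powr a) has_integral Beta (b + 1) (a + 1)) {0..1}"
    using has_integral_Beta_real[of "b + 1" "a + 1"] assms by simp
  then have "weight a b integrable_on unit_ival"
    unfolding has_integral_Icc_iff_Ioo weight_def by (auto simp: mult.commute integrable_on_def)
  then have "weight a b absolutely_integrable_on unit_ival"
    using weight_nonneg by (intro nonnegative_absolutely_integrable_1) auto
  then show ?thesis by (simp add: integrable_restrict_space set_integrable_def)
qed

lemma continuous_on_imp_measurable_unit_ival:
  "continuous_on unit_ival f \<Longrightarrow> (f :: real \<Rightarrow> real) \<in> borel_measurable (lebesgue_on unit_ival)"
  by (rule continuous_imp_measurable_on_sets_lebesgue) auto

lemma integrable_mult_bounded:
  fixes f g :: "'a \<Rightarrow> real"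
  assumes f: "integrable M f"
    and g: "g \<in> borel_measurable M" "\<And>x. x \<in> space M \<Longrightarrow> \<bar>g x\<bar> \<le> B"
  shows "integrable M (\<lambda>x. f x * g x)"
proof (rule Bochner_Integration.integrable_bound)
  show "integrable M (\<lambda>x. B * f x)" using f by simp
  show "(\<lambda>x. f x * g x) \<in> borel_measurable M"
    using borel_measurable_integrable[OF f] g(1) by simp
  show "AE x in M. norm (f x * g x) \<le> norm (B * f x)"
  proof (rule AE_I2)
    fix x assume "x \<in> space M"
    then have "\<bar>g x\<bar> \<le> \<bar>B\<bar>" using g(2)[of x] by simp
    then show "norm (f x * g x) \<le> norm (B * f x)"
      by (simp add: abs_mult mult.commute[of "\<bar>f x\<bar>"] mult_right_mono)
  qed
qed

lemma poly_bounded_unit_ival: "\<exists>B. \<forall>x\<in>unit_ival. \<bar>poly (p :: real poly) x\<bar> \<le> B"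
proof -
  have "compact (poly p ` {0..1})"
    by (intro compact_continuous_image continuous_intros) auto
  then have "bounded (poly p ` {0..1})" by (rule compact_imp_bounded)
  then show ?thesis by (force simp: bounded_real)
qed

lemma poly_measurable_unit_ival: "poly (p :: real poly) \<in> borel_measurable (lebesgue_on unit_ival)"
  by (intro continuous_on_imp_measurable_unit_ival continuous_intros)

lemma integrable_weight_poly:
  assumes "a > -1" "b > -1"
  shows "integrable (lebesgue_on unit_ival) (\<lambda>x. weight a b x * poly p x)"
proof -
  obtain B where "\<forall>x\<in>unit_ival. \<bar>poly p x\<bar> \<le> B" using poly_bounded_unit_ival by blast
  then show ?thesis
    by (intro integrable_mult_bounded[OF integrable_weight[OF assms] poly_measurable_unit_ival]) auto
qed

text \<open>
The inner product of the weighted \<open>L\<^sup>2\<close> space, on polynomials only, so that all integrals exist for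
exponents greater than \<open>-1\<close>.
\<close>

definition wprod :: "real \<Rightarrow> real \<Rightarrow> real poly \<Rightarrow> real poly \<Rightarrow> real" where
  "wprod a b p q = (LINT x|lebesgue_on unit_ival. weight a b x * poly (p * q) x)"

lemma wprod_commute: "wprod a b p q = wprod a b q p"
  by (simp add: wprod_def mult.commute)

lemma wprod_add_right:
  assumes "a > -1" "b > -1"
  shows "wprod a b p (q + r) = wprod a b p q + wprod a b p r"
  using integrable_weight_poly[OF assms, of "p * q"] integrable_weight_poly[OF assms, of "p * r"]
  by (simp add: wprod_def ring_distribs)

lemma wprod_smult_right: "wprod a b p (smult c q) = c * wprod a b p q"
proof -
  have "wprod a b p (smult c q) = (LINT x|lebesgue_on unit_ival. c * (weight a b x * poly (p * q) x))"
    unfolding wprod_def by (simp add: ac_simps)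
  then show ?thesis unfolding wprod_def by simp
qed

lemma wprod_0_right [simp]: "wprod a b p 0 = 0"
  by (simp add: wprod_def)

lemma wprod_sum_right:
  assumes "a > -1" "b > -1"
  shows "wprod a b p (\<Sum>i\<in>A. q i) = (\<Sum>i\<in>A. wprod a b p (q i))"
  by (induction A rule: infinite_finite_induct) (simp_all add: wprod_add_right[OF assms])

lemma wprod_nonneg: "0 \<le> wprod a b p p"
  unfolding wprod_def by (rule Bochner_Integration.integral_nonneg) (simp add: weight_nonneg)

text \<open>
The integrand is the derivative of \<open>weight (a + 1) (b + 1) x * poly p x\<close>, which vanishes at both
endpoints because the raised exponents are positive.
\<close>

lemma integral_weighted_divergence:
  assumes ab: "a > -1" "b > -1"
  shows "(LINT x|lebesgue_on unit_ival. weight a b x *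
      poly ([:b + 1, - (a + b + 2):] * p + [:0, 1, -1:] * pderiv p) x) = 0" (is "integral\<^sup>L _ ?f = 0")
proof -
  let ?F = "\<lambda>x. weight (a + 1) (b + 1) x * poly p x"
  have cont: "continuous_on {0..1} ?F"
    unfolding weight_def using ab by (intro continuous_intros continuous_on_powr') auto
  have der: "(?F has_vector_derivative ?f x) (at x)" if "x \<in> {0<..<1}" for x
  proof -
    have x: "0 < x" "0 < 1 - x" using that by auto
    have e: "(1 - x) powr (a + 1) = (1 - x) powr a * (1 - x)" "x powr (b + 1) = x powr b * x"
      using x by (auto simp: powr_add)
    have "((\<lambda>x. (1 - x) powr (a + 1)) has_real_derivative (a + 1) * (1 - x) powr (a + 1 - of_nat 1) * (- 1)) (at x)"
      by (rule DERIV_fun_powr) (use x in \<open>auto intro!: derivative_eq_intros\<close>)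
    moreover have "((\<lambda>x. x powr (b + 1)) has_real_derivative (b + 1) * x powr (b + 1 - of_nat 1) * 1) (at x)"
      by (rule DERIV_fun_powr) (use x in \<open>auto intro!: derivative_eq_intros\<close>)
    ultimately have "(?F has_real_derivative
       (((a + 1) * (1 - x) powr a * (- 1)) * x powr (b + 1) + ((b + 1) * x powr b * 1) * (1 - x) powr (a + 1)) * poly p x
       + poly (pderiv p) x * ((1 - x) powr (a + 1) * x powr (b + 1))) (at x)"
      unfolding weight_def by (intro DERIV_mult poly_DERIV) simp_all
    also have "(((a + 1) * (1 - x) powr a * (- 1)) * x powr (b + 1) + ((b + 1) * x powr b * 1) * (1 - x) powr (a + 1)) * poly p x
       + poly (pderiv p) x * ((1 - x) powr (a + 1) * x powr (b + 1)) = ?f x"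
      unfolding weight_def e by (simp add: algebra_simps)
    finally show ?thesis by (simp add: has_real_derivative_iff_has_vector_derivative)
  qed
  have "(?f has_integral (?F 1 - ?F 0)) {0..1}"
    by (rule fundamental_theorem_of_calculus_interior[OF _ cont der]) auto
  then have "(?f has_integral 0) {0<..<1}"
    using ab by (simp add: has_integral_Icc_iff_Ioo weight_def)
  moreover have "integrable (lebesgue_on unit_ival) ?f"
    by (rule integrable_weight_poly[OF ab])
  ultimately show ?thesis
    using lebesgue_integral_eq_integral[of unit_ival ?f] by (simp add: integral_unique)
qed

text \<open>
This is \<open>(\<rho>\<^sub>1 p')' / \<rho>\<close> with \<open>\<rho> = weight a b\<close> and \<open>\<rho>\<^sub>1 = weight (a + 1) (b + 1)\<close>, the Sturm-Liouville
operator of the Jacobi polynomials.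
\<close>

definition jacobi_op :: "real \<Rightarrow> real \<Rightarrow> real poly \<Rightarrow> real poly" where
  "jacobi_op a b p = [:0, 1, -1:] * pderiv (pderiv p) + [:b + 1, - (a + b + 2):] * pderiv p"

text \<open>
Integration by parts.  Since the left-hand side is symmetric in \<open>p\<close> and \<open>q\<close>, the operator is
symmetric for \<open>wprod a b\<close>; applied to its eigenfunctions the identity also gives the weighted norms
of their derivatives.
\<close>

lemma wprod_pderiv:
  assumes ab: "a > -1" "b > -1"
  shows "wprod (a + 1) (b + 1) (pderiv p) (pderiv q) = - wprod a b p (jacobi_op a b q)"
proof -
  have "wprod (a + 1) (b + 1) (pderiv p) (pderiv q) =
      (LINT x|lebesgue_on unit_ival. weight a b x * poly ([:0, 1, -1:] * (pderiv p * pderiv q)) x)"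
    unfolding wprod_def
  proof (rule Bochner_Integration.integral_cong)
    fix x assume "x \<in> space (lebesgue_on unit_ival)"
    then have w: "weight (a + 1) (b + 1) x = weight a b x * (x * (1 - x))"
      using weight_Suc[of x a b] by simp
    show "weight (a + 1) (b + 1) x * poly (pderiv p * pderiv q) x =
        weight a b x * poly ([:0, 1, - 1:] * (pderiv p * pderiv q)) x"
      unfolding w by (simp add: algebra_simps)
  qed simp
  then have "wprod (a + 1) (b + 1) (pderiv p) (pderiv q) + wprod a b p (jacobi_op a b q) =
    (LINT x|lebesgue_on unit_ival. weight a b x * poly ([:0, 1, -1:] * (pderiv p * pderiv q)) x +
       weight a b x * poly (p * jacobi_op a b q) x)"
    unfolding wprod_def
    using integrable_weight_poly[OF ab, of "[:0, 1, -1:] * (pderiv p * pderiv q)"]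
      integrable_weight_poly[OF ab, of "p * jacobi_op a b q"] by simp
  also have "\<dots> = (LINT x|lebesgue_on unit_ival. weight a b x *
      poly ([:b + 1, - (a + b + 2):] * (p * pderiv q) + [:0, 1, -1:] * pderiv (p * pderiv q)) x)"
    by (rule Bochner_Integration.integral_cong)
      (simp_all add: jacobi_op_def pderiv_mult algebra_simps)
  also have "\<dots> = 0" by (rule integral_weighted_divergence[OF ab])
  finally show ?thesis by simp
qed

section \<open>The Jacobi differential equation\<close>

definition jpoly :: "real \<Rightarrow> real \<Rightarrow> nat \<Rightarrow> real poly" where
  "jpoly a b n = (\<Sum>m\<le>n. smult (((real n + a) gchoose (n - m)) * ((real n + b) gchoose m))
                          ([:-1, 1:] ^ m * [:0, 1:] ^ (n - m)))"

lemma sjacobi_eq_poly: "sjacobi a b n x = poly (jpoly a b n) x"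
proof -
  have "(2 * x - 1 - 1) / 2 = x - 1" "(2 * x - 1 + 1) / 2 = x" by (auto simp: field_simps)
  then show ?thesis
    unfolding sjacobi_def jacobi_def jpoly_def poly_sum \<open>(2 * x - 1 - 1) / 2 = x - 1\<close> \<open>(2 * x - 1 + 1) / 2 = x\<close>
    by (intro sum.cong) (simp_all add: ac_simps)
qed

lemma pderiv_sum: "pderiv (\<Sum>i\<in>A. p i :: real poly) = (\<Sum>i\<in>A. pderiv (p i))"
  by (induction A rule: infinite_finite_induct) (simp_all add: pderiv_add)

text \<open>
Multiplied by suitable powers of \<open>(x - 1) * x\<close>, the derivatives of \<open>(x - 1) ^ m * x ^ l\<close> are polynomial
multiples of the same product, which avoids exponents such as \<open>m - 1\<close>.
\<close>

lemma poly_pderiv_monomial_product: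
  fixes x :: real and m l :: nat
  defines "E \<equiv> [:-1, 1:] ^ m * [:0, 1:] ^ l :: real poly"
  shows "(x - 1) * x * poly (pderiv E) x = (real m * x + real l * (x - 1)) * poly E x"
    and "((x - 1) * x)\<^sup>2 * poly (pderiv (pderiv E)) x =
      (real m * (real m - 1) * x\<^sup>2 + 2 * real m * real l * (x - 1) * x + real l * (real l - 1) * (x - 1)\<^sup>2) * poly E x"
proof -
  have *: "(x - 1) * x * poly (pderiv E) x = (real m * x + real l * (x - 1)) * poly E x" for x :: real
  proof -
    have 1: "(x - 1) * poly (pderiv ([:-1, 1:] ^ m)) x = m * (x - 1) ^ m"
    proof (cases m)
      case (Suc k)
      have "pderiv ([:-1, 1:] ^ Suc k :: real poly) = smult (1 + real k) ([:-1, 1:] ^ k)"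
        unfolding pderiv_power_Suc by (simp add: pderiv_pCons)
      then show ?thesis using Suc by (simp add: algebra_simps del: power_Suc) (simp add: algebra_simps)
    qed simp
    have 2: "x * poly (pderiv ([:0, 1:] ^ l)) x = l * x ^ l"
    proof (cases l)
      case (Suc k)
      have "pderiv ([:0, 1:] ^ Suc k :: real poly) = smult (1 + real k) ([:0, 1:] ^ k)"
        unfolding pderiv_power_Suc by (simp add: pderiv_pCons)
      then show ?thesis using Suc by (simp add: algebra_simps del: power_Suc) (simp add: algebra_simps)
    qed simp
    have "(x - 1) * x * poly (pderiv E) x =
        x * x ^ l * ((x - 1) * poly (pderiv ([:-1, 1:] ^ m)) x)
        + (x - 1) * (x - 1) ^ m * (x * poly (pderiv ([:0, 1:] ^ l)) x)"
      unfolding E_def by (simp add: pderiv_mult algebra_simps)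
    also have "\<dots> = (real m * x + real l * (x - 1)) * poly E x"
      unfolding 1 2 by (simp add: E_def algebra_simps)
    finally show ?thesis .
  qed
  show "(x - 1) * x * poly (pderiv E) x = (real m * x + real l * (x - 1)) * poly E x"
    by (rule *)
  \<comment> \<open>The second derivative follows by differentiating the first identity \<open>W E' = R E\<close>.\<close>
  define W :: "real poly" where "W = [:0, -1, 1:]"
  define R :: "real poly" where "R = [:- real l, real m + real l:]"
  have W': "pderiv W = [:-1, 2:]" and W: "poly W x = (x - 1) * x"
    by (simp_all add: W_def pderiv_pCons algebra_simps)
  have R': "pderiv R = [:real m + real l:]" and R: "poly R x = m * x + l * (x - 1)"
    by (simp_all add: R_def pderiv_pCons algebra_simps)
  have "poly (W * pderiv E) = poly (R * E)"
    using * by (auto simp: W_def R_def fun_eq_iff algebra_simps)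
  then have "W * pderiv E = R * E" by (simp add: poly_eq_poly_eq_iff)
  then have "poly (pderiv (W * pderiv E)) x = poly (pderiv (R * E)) x" by simp
  then have d: "(x - 1) * x * poly (pderiv (pderiv E)) x =
      (m + l) * poly E x + (real m * x + real l * (x - 1) - (2 * x - 1)) * poly (pderiv E) x"
    unfolding pderiv_mult poly_add poly_mult W' R' W R by (simp add: algebra_simps)
  have "((x - 1) * x)\<^sup>2 * poly (pderiv (pderiv E)) x =
      (x - 1) * x * ((x - 1) * x * poly (pderiv (pderiv E)) x)"
    by (simp add: power2_eq_square)
  also have "\<dots> = (x - 1) * x * (m + l) * poly E x +
      (real m * x + real l * (x - 1) - (2 * x - 1)) * ((x - 1) * x * poly (pderiv E) x)"
    unfolding d by (simp add: algebra_simps)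
  also have "\<dots> = (real m * (real m - 1) * x\<^sup>2 + 2 * real m * real l * (x - 1) * x + real l * (real l - 1) * (x - 1)\<^sup>2) * poly E x"
    unfolding * by (simp add: algebra_simps power2_eq_square)
  finally show "((x - 1) * x)\<^sup>2 * poly (pderiv (pderiv E)) x =
      (real m * (real m - 1) * x\<^sup>2 + 2 * real m * real l * (x - 1) * x + real l * (real l - 1) * (x - 1)\<^sup>2) * poly E x" .
qed

text \<open>
The Jacobi differential equation with eigenvalue \<open>- n * (n + a + b + 1)\<close>.  Multiplied by \<open>(x - 1) * x\<close>, it
becomes a sum of multiples of the products \<open>(x - 1) ^ m * x ^ (n - m)\<close>, and the recursion for the binomial
coefficients makes this sum telescope.
\<close>

lemma jacobi_op_jpoly:
  "jacobi_op a b (jpoly a b n) = smult (- (real n * (real n + a + b + 1))) (jpoly a b n)"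
proof -
  define c where "c m = ((real n + a) gchoose (n - m)) * ((real n + b) gchoose m)" for m
  define E :: "nat \<Rightarrow> real poly" where "E m = [:-1, 1:] ^ m * [:0, 1:] ^ (n - m)" for m
  define lam where "lam = real n * (real n + a + b + 1)"
  have G: "jpoly a b n = (\<Sum>m\<le>n. smult (c m) (E m))"
    by (simp add: jpoly_def c_def E_def)
  have c_rec: "real (Suc m) * (a + real (Suc m)) * c (Suc m) =
      (real n - real m) * (real n + b - real m) * c m" if "m < n" for m
  proof -
    obtain l where l: "n = Suc (m + l)" using less_imp_Suc_add[OF \<open>m < n\<close>] by blast
    have 1: "real (Suc m) * ((real n + b) gchoose Suc m) = (real n + b - real m) * ((real n + b) gchoose m)"
      using gbinomial_mult_1[of "real n + b" m] by (simp add: algebra_simps)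
    have 2: "(real n - real m) * ((real n + a) gchoose Suc l) = (a + real (Suc m)) * ((real n + a) gchoose l)"
      using gbinomial_mult_1[of "real n + a" l] l by (simp add: algebra_simps)
    have "real (Suc m) * (a + real (Suc m)) * c (Suc m) =
       (real (Suc m) * ((real n + b) gchoose Suc m)) * ((a + real (Suc m)) * ((real n + a) gchoose l))"
      using l by (simp add: c_def)
    also have "\<dots> = (real n - real m) * (real n + b - real m) * c m"
      unfolding 1 2[symmetric] using l by (simp add: c_def)
    finally show ?thesis .
  qed
  have "poly ([:0, -1, 1:] * (jacobi_op a b (jpoly a b n) + smult lam (jpoly a b n))) x = 0" for x
  proof -
    define u where "u = x - 1"
    define e where "e m = u ^ m * x ^ (n - m)" for m
    have e: "poly (E m) x = e m" for m by (simp add: E_def e_def u_def)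
    \<comment> \<open>The cut-off at \<open>n\<close> matters: \<open>c (Suc n)\<close> need not vanish, as truncated subtraction makes
        its first binomial coefficient \<open>1\<close>.\<close>
    define A where "A m = (if m \<le> n then - x * (real m * (real m + a) * c m * e m) else 0)" for m
    have uv: "u * x * poly (pderiv (E m)) x = (m * x + (real n - real m) * u) * e m"
      "(u * x)\<^sup>2 * poly (pderiv (pderiv (E m))) x =
      (real m * (real m - 1) * x\<^sup>2 + 2 * real m * (real n - real m) * u * x + (real n - real m) * (real n - m - 1) * u\<^sup>2) * e m"
      if "m \<le> n" for m
      using poly_pderiv_monomial_product[of x m "n - m"] that unfolding E_def[symmetric] e u_def
      by (simp_all add: of_nat_diff)
    have p0: "poly (jpoly a b n) x = (\<Sum>m\<le>n. c m * e m)"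
      by (simp add: G poly_sum e)
    have p1: "poly (pderiv (jpoly a b n)) x = (\<Sum>m\<le>n. c m * poly (pderiv (E m)) x)"
      by (simp add: G poly_sum pderiv_sum pderiv_smult)
    have p2: "poly (pderiv (pderiv (jpoly a b n))) x = (\<Sum>m\<le>n. c m * poly (pderiv (pderiv (E m))) x)"
      by (simp add: G poly_sum pderiv_sum pderiv_smult)
    define k1 k2 where "k1 = ((b + 1) * u + (a + 1) * x) * (u * x)" and "k2 = (u * x)\<^sup>2"
    have "poly ([:0, -1, 1:] * (jacobi_op a b (jpoly a b n) + smult lam (jpoly a b n))) x =
      lam * u * x * poly (jpoly a b n) x - k1 * poly (pderiv (jpoly a b n)) x
        - k2 * poly (pderiv (pderiv (jpoly a b n))) x"
      unfolding jacobi_op_def k1_def k2_def u_def by (simp add: power2_eq_square algebra_simps)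
    also have "\<dots> = (\<Sum>m\<le>n. lam * u * x * (c m * e m) - k1 * (c m * poly (pderiv (E m)) x)
        - k2 * (c m * poly (pderiv (pderiv (E m))) x))"
      unfolding p0 p1 p2 by (simp only: sum_subtractf sum_distrib_left)
    also have "\<dots> = (\<Sum>m\<le>n. c m * (- ((u * x)\<^sup>2 * poly (pderiv (pderiv (E m))) x)
         - ((b + 1) * u + (a + 1) * x) * (u * x * poly (pderiv (E m)) x) + lam * u * x * e m))"
      unfolding k1_def k2_def by (intro sum.cong) (simp_all add: algebra_simps)
    also have "\<dots> = (\<Sum>m\<le>n. A m - A (Suc m))"
    proof (rule sum.cong[OF refl])
      fix m assume "m \<in> {..n}"
      then have m: "m \<le> n" by simp
      have A_Suc: "A (Suc m) = - u * ((real n - real m) * (real n - m + b) * c m * e m)"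
      proof (cases "m < n")
        case True
        then have "n - m = Suc (n - Suc m)" by simp
        then have "x * e (Suc m) = u * e m" by (simp add: e_def)
        moreover have "A (Suc m) = - (real (Suc m) * (a + real (Suc m)) * c (Suc m)) * (x * e (Suc m))"
          using True by (simp add: A_def algebra_simps)
        ultimately have "A (Suc m) = - ((real n - real m) * (real n + b - real m) * c m) * (u * e m)"
          unfolding c_rec[OF True] by simp
        then show ?thesis by (simp add: algebra_simps)
      next
        case False
        then have "m = n" using m by simp
        then show ?thesis by (simp add: A_def)
      qed
      have ux: "u = x - 1" by (simp add: u_def)
      show "c m * (- ((u * x)\<^sup>2 * poly (pderiv (pderiv (E m))) x)
         - ((b + 1) * u + (a + 1) * x) * (u * x * poly (pderiv (E m)) x) + lam * u * x * e m) = A m - A (Suc m)"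
        unfolding uv[OF m] A_Suc unfolding A_def lam_def ux
        using m by (simp add: algebra_simps power2_eq_square)
    qed
    also have "\<dots> = A 0 - A (Suc n)" by (simp add: sum_telescope)
    also have "\<dots> = 0" by (simp add: A_def)
    finally show ?thesis .
  qed
  then have "[:0, -1, 1:] * (jacobi_op a b (jpoly a b n) + smult lam (jpoly a b n)) = 0"
    using poly_all_0_iff_0 by blast
  then have "jacobi_op a b (jpoly a b n) + smult lam (jpoly a b n) = 0"
    unfolding mult_eq_0_iff by simp
  then show ?thesis by (simp add: lam_def eq_neg_iff_add_eq_0)
qed

lemma degree_jpoly_le: "degree (jpoly a b n) \<le> n"
  unfolding jpoly_def
proof (rule degree_sum_le)
  fix m assume "m \<in> {..n}"
  have "degree ([:-1, 1:] ^ m * [:0, 1:] ^ (n - m) :: real poly) \<le> m + (n - m)"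
    by (rule order_trans[OF degree_mult_le]) (intro add_mono, simp_all add: degree_linear_power)
  then show "degree (smult (((real n + a) gchoose (n - m)) * ((real n + b) gchoose m))
      ([:-1, 1:] ^ m * [:0, 1:] ^ (n - m))) \<le> n"
    using \<open>m \<in> {..n}\<close> by (auto intro: order_trans[OF degree_smult_le])
qed simp

text \<open>
By Vandermonde's identity the leading coefficient is \<open>(2 * n + a + b) gchoose n\<close>, all of whose factors are
positive since \<open>a + b > -2\<close>.
\<close>

lemma coeff_jpoly:
  assumes "a > -1" "b > -1"
  shows "coeff (jpoly a b n) n > 0"
proof -
  have c: "coeff ([:-1, 1:] ^ m * [:0, 1:] ^ (n - m) :: real poly) n = 1" if "m \<le> n" for m
  proof -
    let ?p = "[:-1, 1:] ^ m * [:0, 1:] ^ (n - m) :: real poly"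
    have "degree ?p = n" using that by (subst degree_mult_eq) (simp_all add: degree_power_eq)
    moreover have "lead_coeff ?p = 1" by (simp add: lead_coeff_mult lead_coeff_power)
    ultimately show ?thesis by simp
  qed
  have "coeff (jpoly a b n) n = (\<Sum>m\<le>n. ((real n + b) gchoose m) * ((real n + a) gchoose (n - m)))"
    unfolding jpoly_def coeff_sum by (intro sum.cong) (simp_all add: c)
  also have "\<dots> = (real n + b + (real n + a)) gchoose n"
    unfolding atLeast0AtMost[symmetric] by (rule gbinomial_Vandermonde)
  also have "\<dots> > 0"
  proof (cases n)
    case (Suc k)
    then have "real n + b + (real n + a) - real n + 1 > 0" using assms by simp
    then show ?thesis unfolding gbinomial_pochhammer' by (intro divide_pos_pos pochhammer_pos) auto
  qed simp
  finally show ?thesis .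
qed

lemma poly_in_span_jpoly:
  assumes ab: "a > -1" "b > -1" and "degree p \<le> n"
  shows "\<exists>c. p = (\<Sum>j\<le>n. smult (c j) (jpoly a b j))"
  using assms(3)
proof (induction n arbitrary: p)
  case 0
  then obtain d where d: "p = [:d:]" using degree_eq_zeroE by blast
  have "jpoly a b 0 = 1" by (simp add: jpoly_def)
  then show ?case using d by (intro exI[of _ "\<lambda>_. d"]) simp
next
  case (Suc n)
  define g where "g = jpoly a b (Suc n)"
  define d where "d = coeff p (Suc n) / coeff g (Suc n)"
  have g: "coeff g (Suc n) \<noteq> 0" using coeff_jpoly[OF ab, of "Suc n"] by (simp add: g_def)
  have "degree (p - smult d g) \<le> n"
  proof (rule degree_le, intro allI impI)
    fix i assume i: "n < i"
    show "coeff (p - smult d g) i = 0"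
    proof (cases "i = Suc n")
      case True then show ?thesis using g by (simp add: d_def)
    next
      case False
      then have "degree p < i" "degree g < i"
        using Suc.prems degree_jpoly_le[of a b "Suc n"] i unfolding g_def by linarith+
      then show ?thesis by (simp add: coeff_eq_0)
    qed
  qed
  then obtain c where c: "p - smult d g = (\<Sum>j\<le>n. smult (c j) (jpoly a b j))"
    using Suc.IH by blast
  have "p = (\<Sum>j\<le>Suc n. smult ((c(Suc n := d)) j) (jpoly a b j))"
    using c by (simp add: g_def algebra_simps)
  then show ?case by blast
qed

text \<open>
Eigenfunctions of a symmetric operator for different eigenvalues.  The eigenvalues are distinct
because the difference of two of them has the factor \<open>i + j + a + b + 1\<close>, which is positive.
\<close>

lemma wprod_jpoly_orthogonal:
  assumes ab: "a > -1" "b > -1" and "i \<noteq> j"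
  shows "wprod a b (jpoly a b i) (jpoly a b j) = 0"
proof -
  define lam where "lam n = real n * (real n + a + b + 1)" for n
  let ?g = "jpoly a b"
  have *: "wprod (a + 1) (b + 1) (pderiv (?g i)) (pderiv (?g j)) = lam j * wprod a b (?g i) (?g j)" for i j
    using wprod_pderiv[OF ab] by (simp only: jacobi_op_jpoly wprod_smult_right lam_def) simp
  have "lam j * wprod a b (?g i) (?g j) = lam i * wprod a b (?g i) (?g j)"
    using *[of i j] *[of j i] by (simp add: wprod_commute)
  then have "lam i - lam j = 0 \<or> wprod a b (?g i) (?g j) = 0" by auto
  moreover have "lam i - lam j = (real i - real j) * (real i + real j + a + b + 1)"
    by (simp add: lam_def algebra_simps)
  moreover have "real i + real j + a + b + 1 > 0"
  proof -
    have "real i + real j \<ge> 1" using \<open>i \<noteq> j\<close> by linarith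
    then show ?thesis using ab by linarith
  qed
  ultimately show ?thesis using \<open>i \<noteq> j\<close> by auto
qed

section \<open>A pointwise inequality for polynomials\<close>

definition cosine_poly :: "nat \<Rightarrow> (real \<Rightarrow> real) \<Rightarrow> bool" where
  "cosine_poly n f \<longleftrightarrow> (\<exists>c. \<forall>\<theta>. f \<theta> = (\<Sum>j\<le>n. c j * cos (real j * \<theta>)))"

lemma cosine_poly_add:
  assumes "cosine_poly n f" "cosine_poly n g"
  shows "cosine_poly n (\<lambda>\<theta>. f \<theta> + g \<theta>)"
proof -
  obtain c d where "\<And>\<theta>. f \<theta> = (\<Sum>j\<le>n. c j * cos (real j * \<theta>))" "\<And>\<theta>. g \<theta> = (\<Sum>j\<le>n. d j * cos (real j * \<theta>))"
    using assms unfolding cosine_poly_def by blast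
  then show ?thesis unfolding cosine_poly_def
    by (intro exI[of _ "\<lambda>j. c j + d j"]) (simp add: ring_distribs sum.distrib)
qed

lemma cosine_poly_scale:
  assumes "cosine_poly n f"
  shows "cosine_poly n (\<lambda>\<theta>. a * f \<theta>)"
proof -
  obtain c where "\<And>\<theta>. f \<theta> = (\<Sum>j\<le>n. c j * cos (real j * \<theta>))"
    using assms unfolding cosine_poly_def by blast
  then show ?thesis unfolding cosine_poly_def
    by (intro exI[of _ "\<lambda>j. a * c j"]) (simp add: sum_distrib_left mult.assoc)
qed

lemma cosine_poly_cos:
  assumes "j \<le> n"
  shows "cosine_poly n (\<lambda>\<theta>. cos (real j * \<theta>))"
  unfolding cosine_poly_def
  by (intro exI[of _ "\<lambda>i. if i = j then 1 else 0"])
    (use assms in \<open>simp add: if_distrib[of "\<lambda>c. c * _"] sum.delta cong: if_cong\<close>)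

lemma cosine_poly_sum:
  assumes "\<And>j. j \<in> A \<Longrightarrow> cosine_poly n (f j)"
  shows "cosine_poly n (\<lambda>\<theta>. \<Sum>j\<in>A. f j \<theta>)"
  using assms
proof (induction A rule: infinite_finite_induct)
  case (insert x F)
  then show ?case by (simp add: cosine_poly_add)
qed (auto simp: cosine_poly_def intro!: exI[of _ "\<lambda>_. 0"])

text \<open>
The product formula \<open>2 * cos \<theta> * cos (j * \<theta>) = cos ((j - 1) * \<theta>) + cos ((j + 1) * \<theta>)\<close>.
\<close>

lemma cosine_poly_cos_mult:
  assumes "cosine_poly n f"
  shows "cosine_poly (Suc n) (\<lambda>\<theta>. cos \<theta> * f \<theta>)"
proof -
  obtain c where c: "\<And>\<theta>. f \<theta> = (\<Sum>j\<le>n. c j * cos (real j * \<theta>))"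
    using assms unfolding cosine_poly_def by blast
  have "cosine_poly (Suc n) (\<lambda>\<theta>. c j * (cos \<theta> * cos (real j * \<theta>)))" if "j \<le> n" for j
  proof (rule cosine_poly_scale, cases j)
    case 0
    show "cosine_poly (Suc n) (\<lambda>\<theta>. cos \<theta> * cos (real j * \<theta>))"
      using cosine_poly_cos[of 1 "Suc n"] 0 by simp
  next
    case (Suc i)
    have "cosine_poly (Suc n) (\<lambda>\<theta>. 1/2 * (cos (real i * \<theta>) + cos (real (Suc (Suc i)) * \<theta>)))"
      using that Suc by (intro cosine_poly_scale cosine_poly_add cosine_poly_cos) auto
    moreover have "1/2 * (cos (real i * \<theta>) + cos (real (Suc (Suc i)) * \<theta>)) = cos \<theta> * cos (real j * \<theta>)" for \<theta>
    proof -
      have "real i * \<theta> = real j * \<theta> - \<theta>" "real (Suc (Suc i)) * \<theta> = real j * \<theta> + \<theta>"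
        using Suc by (auto simp: algebra_simps)
      then show ?thesis by (simp only: cos_add cos_diff) simp
    qed
    ultimately show "cosine_poly (Suc n) (\<lambda>\<theta>. cos \<theta> * cos (real j * \<theta>))" by simp
  qed
  then have "cosine_poly (Suc n) (\<lambda>\<theta>. \<Sum>j\<le>n. c j * (cos \<theta> * cos (real j * \<theta>)))"
    by (intro cosine_poly_sum) auto
  then show ?thesis by (simp add: c sum_distrib_left mult.left_commute)
qed

lemma cosine_poly_mono:
  assumes "cosine_poly n f" "n \<le> m"
  shows "cosine_poly m f"
proof -
  obtain c where c: "\<And>\<theta>. f \<theta> = (\<Sum>j\<le>n. c j * cos (real j * \<theta>))"
    using assms unfolding cosine_poly_def by blast
  have "cosine_poly m (\<lambda>\<theta>. \<Sum>j\<le>n. c j * cos (real j * \<theta>))"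
    using assms(2) by (intro cosine_poly_sum cosine_poly_scale cosine_poly_cos) auto
  then show ?thesis using c by presburger
qed

lemma cosine_poly_poly:
  assumes "degree p \<le> n"
  shows "cosine_poly n (\<lambda>\<theta>. poly p ((1 - cos \<theta>) / 2))"
  using assms
proof (induction n arbitrary: p)
  case 0
  then obtain d where "p = [:d:]" using degree_eq_zeroE by blast
  then show ?case unfolding cosine_poly_def by (intro exI[of _ "\<lambda>_. d"]) simp
next
  case (Suc n)
  obtain d q where p: "p = pCons d q" by (cases p)
  have "degree q \<le> n" using Suc.prems p by (cases "q = 0") auto
  then have q: "cosine_poly n (\<lambda>\<theta>. poly q ((1 - cos \<theta>) / 2))" by (rule Suc.IH)
  have 1: "cosine_poly (Suc n) (\<lambda>\<theta>. d * cos (real 0 * \<theta>))"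
    by (intro cosine_poly_scale cosine_poly_cos) simp
  have 2: "cosine_poly (Suc n) (\<lambda>\<theta>. 1/2 * poly q ((1 - cos \<theta>) / 2))"
    by (intro cosine_poly_scale cosine_poly_mono[OF q]) simp
  have 3: "cosine_poly (Suc n) (\<lambda>\<theta>. (-1/2) * (cos \<theta> * poly q ((1 - cos \<theta>) / 2)))"
    using q by (intro cosine_poly_scale cosine_poly_cos_mult)
  have "poly p ((1 - cos \<theta>) / 2) = d * cos (real 0 * \<theta>) + 1/2 * poly q ((1 - cos \<theta>) / 2)
      + (-1/2) * (cos \<theta> * poly q ((1 - cos \<theta>) / 2))" for \<theta>
    by (simp add: p field_simps)
  then show ?case using cosine_poly_add[OF cosine_poly_add[OF 1 2] 3] by presburger
qed

lemma has_integral_cos_int: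
  "((\<lambda>\<theta>. cos (of_int m * \<theta>)) has_integral (if m = 0 then pi else 0)) {0..pi}"
proof (cases "m = 0")
  case True
  then show ?thesis using has_integral_const_real[of "1::real" 0 pi] by simp
next
  case False
  have "((\<lambda>\<theta>. cos (of_int m * \<theta>)) has_integral
      (sin (of_int m * pi) / of_int m - sin (of_int m * 0) / of_int m)) {0..pi}"
    using False by (intro fundamental_theorem_of_calculus)
      (auto intro!: derivative_eq_intros simp: has_real_derivative_iff_has_vector_derivative[symmetric])
  then show ?thesis using False by (simp add: mult.commute sin_npi_int)
qed

lemma has_integral_cos_product:
  "((\<lambda>\<theta>. cos (real i * \<theta>) * cos (real j * \<theta>)) has_integral
     (if i = j then if i = 0 then pi else pi / 2 else 0)) {0..pi}"
proof -
  have "((\<lambda>\<theta>. (cos (of_int (int i - int j) * \<theta>) + cos (of_int (int i + int j) * \<theta>)) / 2) has_integral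
     ((if int i - int j = 0 then pi else 0) + (if int i + int j = 0 then pi else 0)) / 2) {0..pi}"
    by (intro has_integral_divide has_integral_add has_integral_cos_int)
  also have "(\<lambda>\<theta>. (cos (of_int (int i - int j) * \<theta>) + cos (of_int (int i + int j) * \<theta>)) / 2) =
      (\<lambda>\<theta>. cos (real i * \<theta>) * cos (real j * \<theta>))"
    by (simp add: fun_eq_iff cos_times_cos ring_distribs)
  finally show ?thesis by (rule has_integral_eq_rhs) auto
qed

lemma cosine_poly_integral_ge:
  fixes c :: "nat \<Rightarrow> real" and n :: nat
  defines "T \<equiv> \<lambda>\<theta>. \<Sum>j\<le>n. c j * cos (real j * \<theta>)"
  shows "pi / 2 * (\<Sum>j\<le>n. (c j)\<^sup>2) \<le> integral {0..pi} (\<lambda>\<theta>. (T \<theta>)\<^sup>2)"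
proof -
  have "((\<lambda>\<theta>. \<Sum>i\<le>n. \<Sum>j\<le>n. c i * c j * (cos (real i * \<theta>) * cos (real j * \<theta>))) has_integral
      (\<Sum>i\<le>n. \<Sum>j\<le>n. c i * c j * (if i = j then if i = 0 then pi else pi / 2 else 0))) {0..pi}"
    by (intro has_integral_sum has_integral_mult_right has_integral_cos_product) auto
  also have "(\<lambda>\<theta>. \<Sum>i\<le>n. \<Sum>j\<le>n. c i * c j * (cos (real i * \<theta>) * cos (real j * \<theta>))) = (\<lambda>\<theta>. (T \<theta>)\<^sup>2)"
    by (simp add: T_def fun_eq_iff power2_eq_square sum_product ac_simps)
  also have "(\<Sum>i\<le>n. \<Sum>j\<le>n. c i * c j * (if i = j then if i = 0 then pi else pi / 2 else 0)) =
      (\<Sum>i\<le>n. (c i)\<^sup>2 * (if i = 0 then pi else pi / 2))"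
    by (intro sum.cong) (simp_all add: if_distrib[of "(*) _"] sum.delta' power2_eq_square cong: if_cong)
  finally have "integral {0..pi} (\<lambda>\<theta>. (T \<theta>)\<^sup>2) = (\<Sum>i\<le>n. (c i)\<^sup>2 * (if i = 0 then pi else pi / 2))"
    by (rule integral_unique)
  also have "\<dots> \<ge> (\<Sum>i\<le>n. (c i)\<^sup>2 * (pi / 2))"
    by (intro sum_mono mult_left_mono) auto
  finally show ?thesis by (simp add: sum_distrib_left mult.commute)
qed

lemma sin_ge_half:
  assumes "0 \<le> x" "x \<le> 1"
  shows "x / 2 \<le> sin (x::real)"
proof (cases "x = 0")
  case False
  then have x: "0 < x" using assms by simp
  have "\<exists>z. 0 < z \<and> z < x \<and> sin x - sin 0 = (x - 0) * cos z"
    by (rule MVT2[OF x]) (auto intro!: derivative_eq_intros)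
  then obtain z where z: "0 < z" "z < x" "sin x = x * cos z" by auto
  have "pi / 3 \<ge> 1" using pi_gt3 by simp
  then have "cos (pi / 3) \<le> cos z" using z assms by (subst cos_mono_le_eq) auto
  then have "x * (1 / 2) \<le> x * cos z" using x by (intro mult_left_mono) (simp_all add: cos_60)
  then show ?thesis using z by simp
qed simp

text \<open>
The square of \<open>T\<close> is at most \<open>n + 1\<close> times the sum of the squared coefficients, so intervals of length \<open>\<eta>\<close>
at both ends of \<open>[0, \<pi>]\<close> contribute at most half of that sum to the integral of \<open>T\<^sup>2\<close>, which is at
least \<open>\<pi> / 2\<close> times the sum.
\<close>

lemma cosine_poly_inner_integral_ge:
  fixes c :: "nat \<Rightarrow> real" and n :: nat
  defines "T \<equiv> \<lambda>\<theta>. \<Sum>j\<le>n. c j * cos (real j * \<theta>)"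
    and "\<eta> \<equiv> 1 / (4 * (real n + 1))"
  shows "(T \<theta>)\<^sup>2 \<le> (real n + 1) * (\<Sum>j\<le>n. (c j)\<^sup>2)"
    and "(\<Sum>j\<le>n. (c j)\<^sup>2) \<le> integral {\<eta>..pi - \<eta>} (\<lambda>\<theta>. (T \<theta>)\<^sup>2)"
proof -
  define S where "S = (\<Sum>j\<le>n. (c j)\<^sup>2)"
  have S: "S \<ge> 0" by (simp add: S_def sum_nonneg)
  have bound: "(T \<theta>)\<^sup>2 \<le> (real n + 1) * S" for \<theta>
  proof -
    have "(T \<theta>)\<^sup>2 \<le> (\<Sum>j\<le>n. (c j)\<^sup>2) * (\<Sum>j\<le>n. (cos (real j * \<theta>))\<^sup>2)"
      unfolding T_def by (rule Cauchy_Schwarz_ineq_sum)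
    also have "\<dots> \<le> S * (\<Sum>j\<le>n. 1)"
      unfolding S_def by (intro mult_left_mono sum_mono sum_nonneg) (simp_all add: abs_square_le_1)
    finally show ?thesis by (simp add: algebra_simps)
  qed
  then show "(T \<theta>)\<^sup>2 \<le> (real n + 1) * (\<Sum>j\<le>n. (c j)\<^sup>2)" by (simp add: S_def)
  have eta: "0 < \<eta>" "\<eta> \<le> 1 / 4" "\<eta> * ((real n + 1) * S) = S / 4" by (auto simp: \<eta>_def field_simps)
  have pi: "pi > 3" by (rule pi_gt3)
  let ?f = "\<lambda>\<theta>. (T \<theta>)\<^sup>2"
  have int: "?f integrable_on {u..v}" for u v
    unfolding T_def by (intro integrable_continuous_real continuous_intros)
  have short: "integral {u..u + \<eta>} ?f \<le> S / 4" for u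
  proof -
    have "integral {u..u + \<eta>} ?f \<le> integral {u..u + \<eta>} (\<lambda>_. (real n + 1) * S)"
      by (rule integral_le[OF int]) (use bound in auto)
    also have "\<dots> = \<eta> * ((real n + 1) * S)" using eta(1) by simp
    finally show ?thesis unfolding eta(3) .
  qed
  have "integral {0..pi} ?f = integral {0..\<eta>} ?f + integral {\<eta>..pi} ?f"
    using eta pi by (intro Henstock_Kurzweil_Integration.integral_combine[symmetric] int) auto
  also have "integral {\<eta>..pi} ?f = integral {\<eta>..pi - \<eta>} ?f + integral {pi - \<eta>..pi} ?f"
    using eta pi by (intro Henstock_Kurzweil_Integration.integral_combine[symmetric] int) auto
  finally have "integral {0..pi} ?f \<le> integral {\<eta>..pi - \<eta>} ?f + S / 2"
    using short[of 0] short[of "pi - \<eta>"] by simp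
  moreover have "pi / 2 * S \<le> integral {0..pi} ?f"
    using cosine_poly_integral_ge[of c n] by (simp add: T_def S_def)
  moreover have "3 / 2 * S \<le> pi / 2 * S" using pi S by (intro mult_right_mono) auto
  ultimately show "(\<Sum>j\<le>n. (c j)\<^sup>2) \<le> integral {\<eta>..pi - \<eta>} ?f"
    by (simp add: S_def)
qed

text \<open>
Under \<open>x = (1 - cos \<theta>) / 2\<close> the product \<open>x * (1 - x)\<close> becomes \<open>(sin \<theta> / 2)\<^sup>2\<close> and \<open>dx\<close> becomes \<open>sin \<theta> / 2 d\<theta>\<close>.
Raising both exponents to \<open>q\<close> makes the weight smaller.
\<close>

lemma weight_circle_ge:
  fixes \<theta> :: real
  assumes "a \<le> q" "b \<le> q" "0 < \<theta>" "\<theta> < pi"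
  shows "(sin \<theta> / 2) powr (2 * q + 1) \<le> weight a b ((1 - cos \<theta>) / 2) * (sin \<theta> / 2)"
proof -
  define x where "x = (1 - cos \<theta>) / 2"
  have s: "sin \<theta> > 0" using assms by (simp add: sin_gt_zero)
  have "x * (1 - x) = (sin \<theta> / 2)\<^sup>2"
  proof -
    have "x * (1 - x) = (1 - (cos \<theta>)\<^sup>2) / 4"
      by (simp add: x_def field_simps power2_eq_square)
    then show ?thesis by (simp add: sin_squared_eq power_divide)
  qed
  moreover have x: "0 \<le> x" "x \<le> 1" by (auto simp: x_def)
  ultimately have "((sin \<theta> / 2)\<^sup>2) powr q = (1 - x) powr q * x powr q"
    by (metis powr_mult mult.commute)
  also have "\<dots> \<le> (1 - x) powr a * x powr b"
    using x assms by (intro mult_mono powr_mono') auto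
  finally have "(sin \<theta> / 2) powr (2 * q) \<le> weight a b x"
    using s by (simp add: weight_def powr_powr flip: powr_numeral)
  then have "(sin \<theta> / 2) powr (2 * q) * (sin \<theta> / 2) \<le> weight a b x * (sin \<theta> / 2)"
    using s by (intro mult_right_mono) auto
  then show ?thesis using s by (simp add: x_def powr_add)
qed

text \<open>
In the variable \<open>\<theta>\<close> the weighted integral of \<open>p\<^sup>2\<close> is at least that of \<open>T\<^sup>2\<close> times
\<open>(sin \<theta> / 2) powr (2 * q + 1)\<close>.  As \<open>2 * q + 1 \<ge> 0\<close>, this factor is at least a constant times \<open>n powr (- 2 * q - 1)\<close>
for angles at distance at least \<open>\<eta>\<close>, of order \<open>1 / n\<close>, from \<open>0\<close> and \<open>\<pi>\<close>.
\<close>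

lemma nikolskii:
  assumes ab: "a > -1" "b > -1" and q: "a \<le> q" "b \<le> q" "-1/2 \<le> q"
    and deg: "degree p \<le> n" and x: "x \<in> {0..1}"
  shows "(poly p x)\<^sup>2 \<le> 16 powr (2 * q + 1) * (real n + 1) powr (2 * q + 2) * wprod a b p p"
proof -
  obtain c where c: "\<And>\<theta>. poly p ((1 - cos \<theta>) / 2) = (\<Sum>j\<le>n. c j * cos (real j * \<theta>))"
    using cosine_poly_poly[OF deg] unfolding cosine_poly_def by blast
  define S where "S = (\<Sum>j\<le>n. (c j)\<^sup>2)"
  define \<eta> where "\<eta> = 1 / (4 * (real n + 1))"
  define g where "g \<theta> = (1 - cos \<theta>) / 2" for \<theta> :: real
  define K where "K = (1 / (16 * (real n + 1))) powr (2 * q + 1)"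
  define f where "f x = weight a b x * poly (p * p) x" for x
  note T = cosine_poly_inner_integral_ge[where c = c and n = n, folded c \<eta>_def S_def g_def]
  have pi: "pi > 3" by (rule pi_gt3)
  have eta: "0 < \<eta>" "\<eta> \<le> 1 / 4" by (auto simp: \<eta>_def field_simps)
  have gI: "g \<theta> \<in> {g \<eta>..g (pi - \<eta>)}" if "\<theta> \<in> {\<eta>..pi - \<eta>}" for \<theta>
    using that eta pi by (auto simp: g_def simp del: cos_pi_minus intro!: cos_monotone_0_pi_le)
  have g01: "0 < g \<eta>" "g (pi - \<eta>) < 1"
  proof -
    have "cos \<eta> < cos 0" using eta pi by (intro cos_monotone_0_pi) auto
    then show "0 < g \<eta>" "g (pi - \<eta>) < 1" by (auto simp: g_def)
  qed
  then have sub: "{g \<eta>..g (pi - \<eta>)} \<subseteq> unit_ival" by auto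
  have contf: "continuous_on {g \<eta>..g (pi - \<eta>)} f"
    unfolding f_def weight_def using g01 by (intro continuous_intros) auto
  have fnn: "f x \<ge> 0" for x by (simp add: f_def weight_nonneg)
  have low: "K * (poly p (g \<theta>))\<^sup>2 \<le> sin \<theta> / 2 * f (g \<theta>)" if th: "\<theta> \<in> {\<eta>..pi - \<eta>}" for \<theta>
  proof -
    have "sin \<theta> \<ge> sin \<eta>"
    proof (cases "\<theta> \<le> pi / 2")
      case True
      then show ?thesis using th eta by (intro sin_monotone_2pi_le) auto
    next
      case False
      then have "sin \<eta> \<le> sin (pi - \<theta>)" using th eta by (intro sin_monotone_2pi_le) auto
      then show ?thesis by simp
    qed
    moreover have "\<eta> / 2 \<le> sin \<eta>" using eta by (intro sin_ge_half) auto
    moreover have "\<eta> / 4 = 1 / (16 * (real n + 1))" by (simp add: \<eta>_def)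
    ultimately have "1 / (16 * (real n + 1)) \<le> sin \<theta> / 2" by linarith
    then have "K \<le> (sin \<theta> / 2) powr (2 * q + 1)"
      unfolding K_def using q by (intro powr_mono2) auto
    also have "\<dots> \<le> weight a b (g \<theta>) * (sin \<theta> / 2)"
      unfolding g_def using th eta q by (intro weight_circle_ge) auto
    finally have "K * (poly p (g \<theta>))\<^sup>2 \<le> weight a b (g \<theta>) * (sin \<theta> / 2) * (poly p (g \<theta>))\<^sup>2"
      by (rule mult_right_mono) simp
    then show ?thesis by (simp add: f_def power2_eq_square ac_simps)
  qed
  have "((\<lambda>\<theta>. (sin \<theta> / 2) *\<^sub>R f (g \<theta>)) has_integral integral {g \<eta>..g (pi - \<eta>)} f) {\<eta>..pi - \<eta>}"
  proof (rule has_integral_substitution[OF _ _ _ contf])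
    show "\<eta> \<le> pi - \<eta>" using eta pi by simp
    then show "g \<eta> \<le> g (pi - \<eta>)" using gI[of \<eta>] by simp
    show "g ` {\<eta>..pi - \<eta>} \<subseteq> {g \<eta>..g (pi - \<eta>)}" using gI by auto
    show "(g has_real_derivative sin \<theta> / 2) (at \<theta> within {\<eta>..pi - \<eta>})" for \<theta>
      unfolding g_def by (auto intro!: derivative_eq_intros)
  qed
  then have subst: "((\<lambda>\<theta>. sin \<theta> / 2 * f (g \<theta>)) has_integral integral {g \<eta>..g (pi - \<eta>)} f) {\<eta>..pi - \<eta>}"
    by simp
  have K: "K > 0" unfolding K_def by simp
  have "K * S \<le> K * integral {\<eta>..pi - \<eta>} (\<lambda>\<theta>. (poly p (g \<theta>))\<^sup>2)"
    using T(2) K by (intro mult_left_mono) auto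
  also have "\<dots> = integral {\<eta>..pi - \<eta>} (\<lambda>\<theta>. K * (poly p (g \<theta>))\<^sup>2)" by simp
  also have "\<dots> \<le> integral {\<eta>..pi - \<eta>} (\<lambda>\<theta>. sin \<theta> / 2 * f (g \<theta>))"
  proof (rule integral_le[OF _ _ low])
    show "(\<lambda>\<theta>. K * (poly p (g \<theta>))\<^sup>2) integrable_on {\<eta>..pi - \<eta>}"
      unfolding g_def by (intro integrable_continuous_real continuous_intros) auto
    show "(\<lambda>\<theta>. sin \<theta> / 2 * f (g \<theta>)) integrable_on {\<eta>..pi - \<eta>}" using subst by blast
  qed
  also have "\<dots> = integral {g \<eta>..g (pi - \<eta>)} f" using subst by (rule integral_unique)
  also have "\<dots> \<le> integral unit_ival f"
  proof (rule integral_subset_le[OF sub])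
    show "f integrable_on {g \<eta>..g (pi - \<eta>)}" using contf by (rule integrable_continuous_real)
    show "f integrable_on unit_ival"
      unfolding f_def by (intro integrable_on_lebesgue_on integrable_weight_poly ab) auto
  qed (use fnn in auto)
  also have "\<dots> = wprod a b p p"
    unfolding wprod_def f_def
    by (intro lebesgue_integral_eq_integral[symmetric] integrable_weight_poly ab) auto
  finally have KS: "K * S \<le> wprod a b p p" .
  have "x = g (arccos (1 - 2 * x))" using x by (simp add: g_def)
  then have "(poly p x)\<^sup>2 \<le> (real n + 1) * S" using T(1)[of "arccos (1 - 2 * x)"] by simp
  also have "\<dots> = (real n + 1) * (16 * (real n + 1)) powr (2 * q + 1) * (K * S)"
    unfolding K_def by (simp add: powr_divide)
  also have "\<dots> \<le> (real n + 1) * (16 * (real n + 1)) powr (2 * q + 1) * wprod a b p p"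
    using KS by (intro mult_left_mono) auto
  also have "(real n + 1) * (16 * (real n + 1)) powr (2 * q + 1) = 16 powr (2 * q + 1) * (real n + 1) powr (2 * q + 2)"
  proof -
    have "(real n + 1) powr (2 * q + 2) = (real n + 1) powr (2 * q + 1) * (real n + 1)"
      using powr_add[of "real n + 1" "2 * q + 1" 1] by (simp add: add.commute)
    moreover have "(16 * (real n + 1)) powr (2 * q + 1) = 16 powr (2 * q + 1) * (real n + 1) powr (2 * q + 1)"
      by (rule powr_mult)
    ultimately show ?thesis by simp
  qed
  finally show ?thesis .
qed

section \<open>The orthonormal basis and derivatives in weighted norms\<close>

lemma wprod_smult_left: "wprod a b (smult c p) q = c * wprod a b p q"
  by (simp add: wprod_smult_right wprod_commute)

lemma wprod_lincomb_orthogonal: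
  assumes ab: "a > -1" "b > -1" and "finite A"
    and orth: "\<And>i j. i \<in> A \<Longrightarrow> j \<in> A \<Longrightarrow> i \<noteq> j \<Longrightarrow> wprod a b (f i) (f j) = 0"
  shows "wprod a b (\<Sum>i\<in>A. smult (c i) (f i)) (\<Sum>i\<in>A. smult (c i) (f i)) =
    (\<Sum>i\<in>A. (c i)\<^sup>2 * wprod a b (f i) (f i))"
proof -
  let ?s = "\<Sum>i\<in>A. smult (c i) (f i)"
  have "wprod a b ?s ?s = (\<Sum>i\<in>A. c i * wprod a b ?s (f i))"
    by (simp add: wprod_sum_right[OF ab] wprod_smult_right)
  also have "\<dots> = (\<Sum>i\<in>A. (c i)\<^sup>2 * wprod a b (f i) (f i))"
  proof (rule sum.cong[OF refl])
    fix i assume i: "i \<in> A"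
    have "wprod a b ?s (f i) = wprod a b (f i) ?s" by (rule wprod_commute)
    also have "\<dots> = (\<Sum>j\<in>A. c j * wprod a b (f i) (f j))"
      by (simp add: wprod_sum_right[OF ab] wprod_smult_right)
    also have "\<dots> = (\<Sum>j\<in>A. if j = i then c i * wprod a b (f i) (f i) else 0)"
      by (intro sum.cong) (use orth[OF i] in auto)
    also have "\<dots> = c i * wprod a b (f i) (f i)"
      using i \<open>finite A\<close> by simp
    finally show "c i * wprod a b ?s (f i) = (c i)\<^sup>2 * wprod a b (f i) (f i)"
      by (simp add: power2_eq_square)
  qed
  finally show ?thesis .
qed

text \<open>
If the integral vanished, \<open>nikolskii\<close> would make \<open>p\<close> vanish on the whole interval.
\<close>

lemma wprod_pos:
  assumes ab: "a > -1" "b > -1" and "p \<noteq> 0"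
  shows "0 < wprod a b p p"
proof (rule ccontr)
  define q where "q = max a (max b 0)"
  have q: "a \<le> q" "b \<le> q" "-1/2 \<le> q" by (auto simp: q_def)
  assume "\<not> 0 < wprod a b p p"
  then have "wprod a b p p = 0" using wprod_nonneg[of a b p] by linarith
  then have "poly p x = 0" if "x \<in> {0..1}" for x
    using nikolskii[OF ab q order_refl that, of p] by simp
  then have "{0..1} \<subseteq> {x. poly p x = 0}" by blast
  then have "finite {0..1::real}" using poly_roots_finite[OF \<open>p \<noteq> 0\<close>] finite_subset by blast
  then show False using infinite_Icc[of 0 "1::real"] by linarith
qed

definition njpoly :: "real \<Rightarrow> real \<Rightarrow> nat \<Rightarrow> real poly" where
  "njpoly a b j = smult (1 / sqrt (wprod a b (jpoly a b j) (jpoly a b j))) (jpoly a b j)"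

lemma njacobi_eq_poly: "njacobi a b j x = poly (njpoly a b j) x"
  by (simp add: njacobi_def njpoly_def sjacobi_eq_poly wprod_def power2_eq_square)

lemma jpoly_wprod_pos:
  assumes "a > -1" "b > -1"
  shows "0 < wprod a b (jpoly a b j) (jpoly a b j)"
  using coeff_jpoly[OF assms, of j] by (intro wprod_pos assms) auto

lemma wprod_njpoly:
  assumes "a > -1" "b > -1"
  shows "wprod a b (njpoly a b i) (njpoly a b j) = (if i = j then 1 else 0)"
  using wprod_jpoly_orthogonal[OF assms, of i j] jpoly_wprod_pos[OF assms, of j]
  by (simp add: njpoly_def wprod_smult_right wprod_smult_left)

lemma poly_in_span_njpoly:
  assumes ab: "a > -1" "b > -1" and deg: "degree p \<le> n"
  shows "\<exists>c. p = (\<Sum>j\<le>n. smult (c j) (njpoly a b j))"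
proof -
  obtain c where c: "p = (\<Sum>j\<le>n. smult (c j) (jpoly a b j))"
    using poly_in_span_jpoly[OF ab deg] by blast
  define d where "d j = c j * sqrt (wprod a b (jpoly a b j) (jpoly a b j))" for j
  have "smult (c j) (jpoly a b j) = smult (d j) (njpoly a b j)" for j
    using jpoly_wprod_pos[OF ab, of j] by (simp add: d_def njpoly_def)
  then show ?thesis using c by auto
qed

lemma degree_njpoly_le: "degree (njpoly a b j) \<le> j"
  unfolding njpoly_def using degree_smult_le degree_jpoly_le order_trans by blast

lemma wprod_pderiv_njpoly:
  assumes ab: "a > -1" "b > -1"
  shows "wprod (a + 1) (b + 1) (pderiv (njpoly a b i)) (pderiv (njpoly a b j)) =
    (if i = j then real j * (real j + a + b + 1) else 0)"
proof -
  have "jacobi_op a b (njpoly a b j) = smult (- (real j * (real j + a + b + 1))) (njpoly a b j)"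
  proof -
    have "jacobi_op a b (smult c p) = smult c (jacobi_op a b p)" for c p
      by (simp add: jacobi_op_def pderiv_smult smult_add_right)
    then show ?thesis unfolding njpoly_def by (simp add: jacobi_op_jpoly mult.commute)
  qed
  then show ?thesis
    using wprod_njpoly[OF ab, of i j] by (simp only: wprod_pderiv[OF ab] wprod_smult_right) simp
qed

text \<open>
Both sides are diagonal in the coefficients of \<open>p\<close>: the left-hand side weighs the \<open>j\<close>-th square with the
eigenvalue \<open>j * (j + a + b + 1)\<close>, and these eigenvalues increase with \<open>j\<close>.
\<close>

lemma bernstein_L2:
  assumes ab: "a > -1" "b > -1" and deg: "degree p \<le> n"
  shows "wprod (a + 1) (b + 1) (pderiv p) (pderiv p) \<le> real n * (real n + a + b + 1) * wprod a b p p"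
proof -
  define lam where "lam j = real j * (real j + a + b + 1)" for j
  obtain c where c: "p = (\<Sum>j\<le>n. smult (c j) (njpoly a b j))"
    using poly_in_span_njpoly[OF ab deg] by blast
  have p: "wprod a b p p = (\<Sum>j\<le>n. (c j)\<^sup>2)"
    unfolding c by (subst wprod_lincomb_orthogonal[OF ab]) (simp_all add: wprod_njpoly[OF ab])
  have "pderiv p = (\<Sum>j\<le>n. smult (c j) (pderiv (njpoly a b j)))"
    unfolding c by (simp add: pderiv_sum pderiv_smult)
  then have "wprod (a + 1) (b + 1) (pderiv p) (pderiv p) = (\<Sum>j\<le>n. (c j)\<^sup>2 * lam j)"
    using ab by (simp add: wprod_lincomb_orthogonal wprod_pderiv_njpoly lam_def)
  also have "\<dots> \<le> (\<Sum>j\<le>n. (c j)\<^sup>2 * lam n)"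
  proof (intro sum_mono mult_left_mono)
    fix j assume "j \<in> {..n}"
    have "0 \<le> (real n - real j) * (real n + real j + a + b + 1)"
    proof (cases "j = n")
      case False
      then have "real n + real j \<ge> 1" "real n \<ge> real j" using \<open>j \<in> {..n}\<close> by auto
      then show ?thesis using ab by (intro mult_nonneg_nonneg) auto
    qed simp
    also have "\<dots> = lam n - lam j" by (simp add: lam_def algebra_simps)
    finally show "lam j \<le> lam n" by simp
  qed simp
  finally show ?thesis by (simp add: p lam_def sum_distrib_right[symmetric] mult.commute)
qed

lemma degree_higher_pderiv_le: "degree ((pderiv ^^ k) p) \<le> degree (p :: real poly)"
proof (induction k)
  case (Suc k)
  then show ?case by (simp add: degree_pderiv)
qed simp

lemma bernstein_L2_higher:
  assumes ab: "a > -1" "b > -1"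
  shows "\<exists>D\<ge>0. \<forall>n p. degree p \<le> n \<longrightarrow>
    wprod (a + real k) (b + real k) ((pderiv ^^ k) p) ((pderiv ^^ k) p) \<le> D * (real n + 1) ^ (2 * k) * wprod a b p p"
proof (induction k)
  case 0
  show ?case by (intro exI[of _ 1]) simp
next
  case (Suc k)
  then obtain D where D: "D \<ge> 0" "\<And>n p. degree p \<le> n \<Longrightarrow>
    wprod (a + real k) (b + real k) ((pderiv ^^ k) p) ((pderiv ^^ k) p) \<le> D * (real n + 1) ^ (2 * k) * wprod a b p p"
    by blast
  define E where "E = 1 + \<bar>a + b + 2 * real k + 1\<bar>"
  have "wprod (a + real (Suc k)) (b + real (Suc k)) ((pderiv ^^ Suc k) p) ((pderiv ^^ Suc k) p)
      \<le> E * D * (real n + 1) ^ (2 * Suc k) * wprod a b p p" if deg: "degree p \<le> n" for n p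
  proof -
    let ?q = "(pderiv ^^ k) p"
    have q: "degree ?q \<le> n" using deg degree_higher_pderiv_le order_trans by blast
    have lam: "real n * (real n + (a + real k) + (b + real k) + 1) \<le> E * (real n + 1)\<^sup>2"
    proof -
      have "real n + (a + real k) + (b + real k) + 1 \<le> real n + E" by (simp add: E_def)
      also have "\<dots> \<le> E * (real n + 1)" by (simp add: E_def algebra_simps)
      finally have "real n * (real n + (a + real k) + (b + real k) + 1) \<le> real n * (E * (real n + 1))"
        by (rule mult_left_mono) simp
      also have "\<dots> \<le> (real n + 1) * (E * (real n + 1))"
        by (intro mult_right_mono mult_nonneg_nonneg) (simp_all add: E_def)
      finally show ?thesis by (simp add: power2_eq_square ac_simps)
    qed
    have "wprod (a + real (Suc k)) (b + real (Suc k)) (pderiv ?q) (pderiv ?q)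
        = wprod (a + real k + 1) (b + real k + 1) (pderiv ?q) (pderiv ?q)" by (simp add: ac_simps)
    also have "\<dots> \<le> real n * (real n + (a + real k) + (b + real k) + 1) * wprod (a + real k) (b + real k) ?q ?q"
      by (rule bernstein_L2) (use ab q in auto)
    also have "\<dots> \<le> E * (real n + 1)\<^sup>2 * (D * (real n + 1) ^ (2 * k) * wprod a b p p)"
      by (rule mult_mono[OF lam D(2)[OF deg]]) (simp_all add: wprod_nonneg E_def)
    finally show ?thesis by (simp add: power2_eq_square ac_simps)
  qed
  moreover have "E * D \<ge> 0" using D by (simp add: E_def)
  ultimately show ?case by blast
qed

text \<open>
Differentiation is estimated in the weighted norms first, and the pointwise inequality is used only
for the resulting weight, with exponents \<open>a + k\<close> and \<open>b + k\<close>.  In the opposite order, with Markov's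
inequality for the sup norm, the exponent of \<open>n\<close> would be too large when \<open>a\<close> and \<open>b\<close> are less than \<open>-1/2\<close>.
\<close>

lemma nikolskii_higher_pderiv:
  assumes ab: "a > -1" "b > -1" and q: "a + real k \<le> q" "b + real k \<le> q" "-1/2 \<le> q"
  shows "\<exists>C\<ge>0. \<forall>n p x. degree p \<le> n \<longrightarrow> x \<in> {0..1} \<longrightarrow>
    (poly ((pderiv ^^ k) p) x)\<^sup>2 \<le> C * (real n + 1) powr (2 * (real k + 1 + q)) * wprod a b p p"
proof -
  obtain D where D: "D \<ge> 0" "\<And>n p. degree p \<le> n \<Longrightarrow>
    wprod (a + real k) (b + real k) ((pderiv ^^ k) p) ((pderiv ^^ k) p) \<le> D * (real n + 1) ^ (2 * k) * wprod a b p p"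
    using bernstein_L2_higher[OF ab, of k] by blast
  define C where "C = 16 powr (2 * q + 1) * D"
  have "(poly ((pderiv ^^ k) p) x)\<^sup>2 \<le> C * (real n + 1) powr (2 * (real k + 1 + q)) * wprod a b p p"
    if "degree p \<le> n" "x \<in> {0..1}" for n p x
  proof -
    let ?q = "(pderiv ^^ k) p"
    have "degree ?q \<le> n" using that degree_higher_pderiv_le order_trans by blast
    then have "(poly ?q x)\<^sup>2 \<le> 16 powr (2 * q + 1) * (real n + 1) powr (2 * q + 2) *
        wprod (a + real k) (b + real k) ?q ?q"
      using ab q that by (intro nikolskii) auto
    also have "\<dots> \<le> 16 powr (2 * q + 1) * (real n + 1) powr (2 * q + 2) * (D * (real n + 1) ^ (2 * k) * wprod a b p p)"
      using D(2)[OF that(1)] by (intro mult_left_mono) auto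
    also have "\<dots> = C * ((real n + 1) powr (2 * q + 2) * (real n + 1) ^ (2 * k)) * wprod a b p p"
      by (simp add: C_def ac_simps)
    also have "(real n + 1) powr (2 * q + 2) * (real n + 1) ^ (2 * k) = (real n + 1) powr (2 * (real k + 1 + q))"
    proof -
      have "(real n + 1) ^ (2 * k) = (real n + 1) powr real (2 * k)" by (rule powr_realpow[symmetric]) simp
      then show ?thesis by (simp add: powr_add[symmetric] algebra_simps)
    qed
    finally show ?thesis .
  qed
  moreover have "C \<ge> 0" using D by (simp add: C_def)
  ultimately show ?thesis by blast
qed

lemma higher_pderiv_lincomb:
  "(pderiv ^^ k) (\<Sum>i\<in>A. smult (c i) (p i)) = (\<Sum>i\<in>A. smult (c i) ((pderiv ^^ k) (p i :: real poly)))"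
  by (induction k) (simp_all add: pderiv_sum pderiv_smult)

section \<open>Partial sums of Jacobi expansions\<close>

text \<open>
Duality: the polynomial whose coefficients are the values \<open>e j\<close> of the \<open>k\<close>-th derivatives at \<open>x\<close> has
\<open>k\<close>-th derivative \<open>K\<close> at \<open>x\<close> and squared weighted norm \<open>K\<close>, where \<open>K\<close> is the kernel.  So \<open>K\<^sup>2\<close> is bounded
by a multiple of \<open>K\<close>.
\<close>

lemma jacobi_kernel_bound:
  assumes ab: "a > -1" "b > -1" and q: "a + real k \<le> q" "b + real k \<le> q" "-1/2 \<le> q"
  shows "\<exists>C\<ge>0. \<forall>n. \<forall>x\<in>{0..1}.
    (\<Sum>j\<le>n. (poly ((pderiv ^^ k) (njpoly a b j)) x)\<^sup>2) \<le> C * (real n + 1) powr (2 * (real k + 1 + q))"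
proof -
  obtain C where C: "C \<ge> 0" "\<And>n p x. degree p \<le> n \<Longrightarrow> x \<in> {0..1} \<Longrightarrow>
    (poly ((pderiv ^^ k) p) x)\<^sup>2 \<le> C * (real n + 1) powr (2 * (real k + 1 + q)) * wprod a b p p"
    using nikolskii_higher_pderiv[OF ab q] by blast
  have "(\<Sum>j\<le>n. (poly ((pderiv ^^ k) (njpoly a b j)) x)\<^sup>2) \<le> C * (real n + 1) powr (2 * (real k + 1 + q))"
    if x: "x \<in> {0..1}" for n x
  proof -
    define e where "e j = poly ((pderiv ^^ k) (njpoly a b j)) x" for j
    define K where "K = (\<Sum>j\<le>n. (e j)\<^sup>2)"
    define p where "p = (\<Sum>j\<le>n. smult (e j) (njpoly a b j))"
    have "degree p \<le> n"
      unfolding p_def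
      by (rule degree_sum_le) (auto intro: order_trans[OF degree_smult_le] order_trans[OF degree_njpoly_le])
    moreover have "poly ((pderiv ^^ k) p) x = K"
      by (simp add: p_def higher_pderiv_lincomb poly_sum e_def[symmetric] K_def power2_eq_square)
    moreover have "wprod a b p p = K"
      unfolding p_def K_def
      by (subst wprod_lincomb_orthogonal[OF ab]) (simp_all add: wprod_njpoly[OF ab])
    ultimately have "K * K \<le> C * (real n + 1) powr (2 * (real k + 1 + q)) * K"
      using C(2)[of p n x] x by (simp add: power2_eq_square)
    moreover have "K \<ge> 0" by (simp add: K_def sum_nonneg)
    ultimately have "K \<le> C * (real n + 1) powr (2 * (real k + 1 + q))"
      using C(1) by (cases "K = 0") (auto simp: mult_le_cancel_right)
    then show ?thesis by (simp add: K_def e_def)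
  qed
  then show ?thesis using C(1) by blast
qed

text \<open>
On the block \<open>2 ^ m \<le> j < 2 ^ Suc m\<close> the factor \<open>(1 + j\<^sup>2) powr (- s)\<close> is at most \<open>4 powr (- s * m)\<close>, while the
\<open>e j\<close> sum to at most a constant times \<open>4 powr (r * m)\<close>.  As \<open>r < s\<close>, the blocks are dominated by a geometric
series.
\<close>

lemma dyadic_summation:
  fixes r s :: real
  assumes "r < s" "0 \<le> s"
  shows "\<exists>B\<ge>0. \<forall>e C. (\<forall>j. 0 \<le> e j) \<and> (\<forall>n. (\<Sum>j\<le>n. e j) \<le> C * (real n + 1) powr (2 * r)) \<longrightarrow>
    (\<forall>n. (\<Sum>j<n. e j * (1 + (real j)\<^sup>2) powr (- s)) \<le> B * C)"
proof -
  define \<rho> :: real where "\<rho> = 4 powr (r - s)"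
  have "4 powr (r - s) < (4::real) powr 0" using assms by (intro powr_less_mono) auto
  then have \<rho>: "0 < \<rho>" "\<rho> < 1" by (auto simp: \<rho>_def)
  define B where "B = 1 + 4 powr r / (1 - \<rho>)"
  have B: "B \<ge> 0" using \<rho> by (simp add: B_def)
  have "(\<Sum>j<n. e j * (1 + (real j)\<^sup>2) powr (- s)) \<le> B * C"
    if e: "\<And>j. 0 \<le> e j" and K: "\<And>n. (\<Sum>j\<le>n. e j) \<le> C * (real n + 1) powr (2 * r)" for e C n
  proof -
    define d where "d j = (1 + (real j)\<^sup>2) powr (- s)" for j
    have C: "0 \<le> C" using K[of 0] e[of 0] by simp
    have block: "(\<Sum>j\<in>{2 ^ m..<2 ^ Suc m}. e j * d j) \<le> C * 4 powr r * \<rho> ^ m" for m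
    proof -
      have four: "(4::real) ^ m = 4 powr real m" by (simp add: powr_realpow)
      have "d j \<le> (4 powr (- s)) ^ m" if "j \<in> {2 ^ m..<2 ^ Suc m}" for j
      proof -
        have "(2::real) ^ m \<le> real j" using that by (metis atLeastLessThan_iff of_nat_le_iff of_nat_numeral of_nat_power)
        then have "((2::real) ^ m)\<^sup>2 \<le> (real j)\<^sup>2" by (intro power_mono) auto
        then have "(4::real) ^ m \<le> 1 + (real j)\<^sup>2" by (simp add: power2_eq_square flip: power_mult_distrib)
        then have "d j \<le> (4 ^ m) powr (- s)"
          unfolding d_def using assms by (intro powr_mono2') auto
        also have "\<dots> = (4 powr (- s)) ^ m" unfolding four by (simp add: powr_powr powr_power mult.commute)
        finally show ?thesis .
      qed
      then have "(\<Sum>j\<in>{2 ^ m..<2 ^ Suc m}. e j * d j) \<le> (\<Sum>j\<in>{2 ^ m..<2 ^ Suc m}. e j * (4 powr (- s)) ^ m)"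
        using e by (intro sum_mono mult_left_mono) auto
      also have "\<dots> = (\<Sum>j\<in>{2 ^ m..<2 ^ Suc m}. e j) * (4 powr (- s)) ^ m"
        by (simp add: sum_distrib_right)
      also have "(\<Sum>j\<in>{2 ^ m..<2 ^ Suc m}. e j) \<le> (\<Sum>j\<le>2 ^ Suc m - 1. e j)"
        using e by (intro sum_mono2) auto
      also have "\<dots> \<le> C * (real (2 ^ Suc m - 1) + 1) powr (2 * r)" by (rule K)
      also have "real (2 ^ Suc m - 1) + 1 = 2 ^ Suc m" by (simp add: of_nat_diff)
      also have "(2 ^ Suc m :: real) powr (2 * r) = 4 powr r * (4 powr r) ^ m"
      proof -
        have "(4::real) powr r = (2 powr 2) powr r" by simp
        then have four_r: "(4::real) powr r = 2 powr (2 * r)" by (simp only: powr_powr)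
        have "(2 ^ Suc m :: real) = 2 powr real (Suc m)" by (rule powr_realpow[symmetric]) simp
        then have "(2 ^ Suc m :: real) powr (2 * r) = 2 powr (real (Suc m) * (2 * r))"
          by (simp only: powr_powr)
        also have "\<dots> = (4 powr r) ^ Suc m" unfolding four_r by (simp only: powr_power)
        finally show ?thesis by simp
      qed
      finally have "(\<Sum>j\<in>{2 ^ m..<2 ^ Suc m}. e j * d j) \<le>
          C * (4 powr r * (4 powr r) ^ m) * (4 powr (- s)) ^ m" by simp
      also have "\<dots> = C * 4 powr r * ((4 powr r) * (4 powr (- s))) ^ m"
        by (simp add: power_mult_distrib)
      also have "(4::real) powr r * 4 powr (- s) = \<rho>" by (simp add: \<rho>_def powr_add[symmetric])
      finally show ?thesis .
    qed
    have geo: "(\<Sum>m<M. \<rho> ^ m) \<le> 1 / (1 - \<rho>)" for M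
    proof -
      have "summable (\<lambda>m. \<rho> ^ m)" using \<rho> by (intro summable_geometric) auto
      then have "(\<Sum>m<M. \<rho> ^ m) \<le> (\<Sum>m. \<rho> ^ m)" using \<rho> by (intro sum_le_suminf) auto
      then show ?thesis using \<rho> by (simp add: suminf_geometric)
    qed
    have "(\<Sum>j<2 ^ M. e j * d j) \<le> C + C * 4 powr r * (\<Sum>m<M. \<rho> ^ m)" for M
    proof (induction M)
      case 0
      have "e 0 \<le> C" using K[of 0] by simp
      then show ?case by (simp add: d_def)
    next
      case (Suc M)
      have "(\<Sum>j<2 ^ Suc M. e j * d j) = (\<Sum>j<2 ^ M. e j * d j) + (\<Sum>j\<in>{2 ^ M..<2 ^ Suc M}. e j * d j)"
        unfolding lessThan_atLeast0 by (rule sum.atLeastLessThan_concat[symmetric]) simp_all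
      then show ?case using Suc.IH block[of M] by (simp add: ring_distribs)
    qed
    moreover have "C + C * 4 powr r * (\<Sum>m<M. \<rho> ^ m) \<le> B * C" for M
    proof -
      have "C * 4 powr r * (\<Sum>m<M. \<rho> ^ m) \<le> C * 4 powr r * (1 / (1 - \<rho>))"
        using C geo by (intro mult_left_mono) auto
      then show ?thesis by (simp add: B_def algebra_simps)
    qed
    ultimately have "(\<Sum>j<2 ^ n. e j * d j) \<le> B * C" using order_trans by blast
    moreover have "(\<Sum>j<n. e j * d j) \<le> (\<Sum>j<2 ^ n. e j * d j)"
      using e less_exp[of n] by (intro sum_mono2) (auto simp: d_def)
    ultimately show ?thesis by (simp add: d_def)
  qed
  then show ?thesis using B by blast
qed

text \<open>
Cauchy-Schwarz with the factors \<open>(1 + j\<^sup>2) powr (s / 2)\<close> and their inverses; the hypothesis on \<open>s\<close> says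
exactly that \<open>s\<close> exceeds half the growth exponent in the kernel bound.
\<close>

lemma jacobi_expansion_bound:
  assumes ab: "a > -1" "b > -1"
    and s: "s > real k + 1 + Max {a + real k, b + real k, - 1 / 2}"
  shows "\<exists>B\<ge>0. \<forall>c m n. \<forall>x\<in>unit_ival.
    \<bar>poly ((pderiv ^^ k) (\<Sum>j\<in>{m..<n}. smult (c j) (njpoly a b j))) x\<bar>
      \<le> B * sqrt (\<Sum>j\<in>{m..<n}. (1 + (real j)\<^sup>2) powr s * (c j)\<^sup>2)"
proof -
  define q where "q = Max {a + real k, b + real k, - 1 / 2}"
  have q: "a + real k \<le> q" "b + real k \<le> q" "-1/2 \<le> q" by (auto simp: q_def)
  obtain C where C: "C \<ge> 0" "\<And>n x. x \<in> {0..1} \<Longrightarrow>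
    (\<Sum>j\<le>n. (poly ((pderiv ^^ k) (njpoly a b j)) x)\<^sup>2) \<le> C * (real n + 1) powr (2 * (real k + 1 + q))"
    using jacobi_kernel_bound[OF ab q] by blast
  have rs: "real k + 1 + q < s" using s unfolding q_def .
  then have s0: "0 \<le> s" using q(3) by linarith
  obtain B where B: "B \<ge> 0" "\<And>e C n. (\<And>j. 0 \<le> e j) \<Longrightarrow>
      (\<And>n. (\<Sum>j\<le>n. e j) \<le> C * (real n + 1) powr (2 * (real k + 1 + q))) \<Longrightarrow>
      (\<Sum>j<n. e j * (1 + (real j)\<^sup>2) powr (- s)) \<le> B * C"
    using dyadic_summation[OF rs s0] by blast
  have "\<bar>poly ((pderiv ^^ k) (\<Sum>j\<in>{m..<n}. smult (c j) (njpoly a b j))) x\<bar>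
      \<le> sqrt (B * C) * sqrt (\<Sum>j\<in>{m..<n}. (1 + (real j)\<^sup>2) powr s * (c j)\<^sup>2)"
    if x: "x \<in> unit_ival" for c m n x
  proof -
    define e where "e j = poly ((pderiv ^^ k) (njpoly a b j)) x" for j
    define u where "u j = (1 + (real j)\<^sup>2) powr (s / 2)" for j
    have u: "u j > 0" "(u j)\<^sup>2 = (1 + (real j)\<^sup>2) powr s" "(1 / u j)\<^sup>2 = (1 + (real j)\<^sup>2) powr (- s)" for j
    proof -
      have "1 + (real j)\<^sup>2 > 0" by (simp add: add_pos_nonneg)
      then show "u j > 0" "(u j)\<^sup>2 = (1 + (real j)\<^sup>2) powr s"
        by (simp_all add: u_def power2_eq_square powr_add[symmetric])
      then show "(1 / u j)\<^sup>2 = (1 + (real j)\<^sup>2) powr (- s)"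
        by (simp add: power_one_over powr_minus_divide)
    qed
    have "poly ((pderiv ^^ k) (\<Sum>j\<in>{m..<n}. smult (c j) (njpoly a b j))) x = (\<Sum>j\<in>{m..<n}. c j * e j)"
      by (simp add: higher_pderiv_lincomb poly_sum e_def)
    also have "\<dots> = (\<Sum>j\<in>{m..<n}. (u j * c j) * (e j * (1 / u j)))"
    proof (rule sum.cong[OF refl])
      show "c j * e j = (u j * c j) * (e j * (1 / u j))" for j
        using u(1)[of j] by simp
    qed
    also have "(\<dots>)\<^sup>2 \<le> (\<Sum>j\<in>{m..<n}. (u j * c j)\<^sup>2) * (\<Sum>j\<in>{m..<n}. (e j * (1 / u j))\<^sup>2)"
      by (rule Cauchy_Schwarz_ineq_sum)
    also have "(\<Sum>j\<in>{m..<n}. (u j * c j)\<^sup>2) = (\<Sum>j\<in>{m..<n}. (1 + (real j)\<^sup>2) powr s * (c j)\<^sup>2)"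
      by (simp only: power_mult_distrib u)
    also have "(\<Sum>j\<in>{m..<n}. (e j * (1 / u j))\<^sup>2) = (\<Sum>j\<in>{m..<n}. (e j)\<^sup>2 * (1 + (real j)\<^sup>2) powr (- s))"
      by (simp only: power_mult_distrib u)
    also have "\<dots> \<le> (\<Sum>j<n. (e j)\<^sup>2 * (1 + (real j)\<^sup>2) powr (- s))"
      by (intro sum_mono2) auto
    also have "\<dots> \<le> B * C"
      by (rule B(2)) (use C(2)[of x] x in \<open>auto simp: e_def\<close>)
    finally have "(poly ((pderiv ^^ k) (\<Sum>j\<in>{m..<n}. smult (c j) (njpoly a b j))) x)\<^sup>2
        \<le> (\<Sum>j\<in>{m..<n}. (1 + (real j)\<^sup>2) powr s * (c j)\<^sup>2) * (B * C)"
      by (simp add: mult_left_mono sum_nonneg)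
    then have "\<bar>poly ((pderiv ^^ k) (\<Sum>j\<in>{m..<n}. smult (c j) (njpoly a b j))) x\<bar>
        \<le> sqrt ((\<Sum>j\<in>{m..<n}. (1 + (real j)\<^sup>2) powr s * (c j)\<^sup>2) * (B * C))"
      by (intro real_le_rsqrt) simp
    then show ?thesis by (simp add: real_sqrt_mult mult.commute)
  qed
  moreover have "sqrt (B * C) \<ge> 0" using B C by simp
  ultimately show ?thesis by blast
qed

section \<open>Completeness of the Jacobi polynomials\<close>

text \<open>
Uniform approximation of \<open>g\<close> by polynomials on \<open>[0, 1]\<close>.
\<close>

lemma integral_mult_continuous_eq_0:
  assumes F: "integrable (lebesgue_on unit_ival) F"
    and orth: "\<And>p :: real poly. (LINT x|lebesgue_on unit_ival. F x * poly p x) = 0"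
    and g: "continuous_on UNIV (g :: real \<Rightarrow> real)"
  shows "(LINT x|lebesgue_on unit_ival. F x * g x) = 0"
proof (rule ccontr)
  let ?M = "lebesgue_on unit_ival"
  let ?I = "\<lambda>g. LINT x|?M. F x * g x"
  define A where "A = (LINT x|?M. \<bar>F x\<bar>)"
  assume "?I g \<noteq> 0"
  have A: "0 \<le> A" unfolding A_def by (rule Bochner_Integration.integral_nonneg) simp
  define e where "e = \<bar>?I g\<bar> / (2 * (A + 1))"
  have e: "e > 0" using A \<open>?I g \<noteq> 0\<close> by (simp add: e_def)
  have gI: "continuous_on {0..1} g" using g continuous_on_subset by blast
  obtain P where P: "real_polynomial_function P" "\<And>x. x \<in> {0..1} \<Longrightarrow> \<bar>g x - P x\<bar> < e"
    using Stone_Weierstrass_real_polynomial_function[OF compact_Icc gI e] by blast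
  obtain c n where "P = (\<lambda>x. \<Sum>i\<le>n. c i * x ^ i)"
    using P(1) unfolding real_polynomial_function_iff_sum by blast
  then have "P x = poly (\<Sum>i\<le>n. monom (c i) i) x" for x
    by (simp add: poly_sum poly_monom)
  then obtain p where p: "\<And>x. x \<in> {0..1} \<Longrightarrow> \<bar>g x - poly p x\<bar> < e"
    using P(2) by metis
  have "bounded (g ` {0..1})"
    using compact_continuous_image[OF gI compact_Icc] by (rule compact_imp_bounded)
  then obtain B where B: "\<forall>x\<in>{0..1}. \<bar>g x\<bar> \<le> B" by (auto simp: bounded_real)
  have gm: "g \<in> borel_measurable ?M"
    using g continuous_on_subset by (intro continuous_on_imp_measurable_unit_ival) blast
  have ig: "integrable ?M (\<lambda>x. F x * g x)"
    by (rule integrable_mult_bounded[OF F gm]) (use B in auto)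
  obtain B' where B': "\<forall>x\<in>unit_ival. \<bar>poly p x\<bar> \<le> B'" using poly_bounded_unit_ival by blast
  have ip: "integrable ?M (\<lambda>x. F x * poly p x)"
    by (rule integrable_mult_bounded[OF F poly_measurable_unit_ival]) (use B' in auto)
  have id: "integrable ?M (\<lambda>x. F x * (g x - poly p x))"
    using Bochner_Integration.integrable_diff[OF ig ip] by (simp add: right_diff_distrib)
  have "?I g = ?I g - ?I (poly p)" using orth by simp
  also have "\<dots> = (LINT x|?M. F x * (g x - poly p x))"
    using Bochner_Integration.integral_diff[OF ig ip] by (simp add: right_diff_distrib)
  finally have "\<bar>?I g\<bar> \<le> (LINT x|?M. \<bar>F x * (g x - poly p x)\<bar>)"
    by (metis integral_abs_bound)
  also have "\<dots> \<le> (LINT x|?M. e * \<bar>F x\<bar>)"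
  proof (rule Bochner_Integration.integral_mono)
    show "\<bar>F x * (g x - poly p x)\<bar> \<le> e * \<bar>F x\<bar>" if "x \<in> space ?M" for x
    proof -
      have "\<bar>g x - poly p x\<bar> \<le> e" using p[of x] that by simp
      then show ?thesis by (simp add: abs_mult mult.commute[of e] mult_left_mono)
    qed
  qed (use id F in auto)
  also have "\<dots> = e * A" by (simp add: A_def)
  also have "\<dots> \<le> e * (A + 1)" using e by simp
  also have "\<dots> = \<bar>?I g\<bar> / 2" using A by (simp add: e_def divide_simps)
  finally show False using \<open>?I g \<noteq> 0\<close> by simp
qed

text \<open>
The sign of \<open>F\<close>, being measurable, is almost everywhere a limit of continuous functions, which can be
truncated to \<open>[-1, 1]\<close>.  The integrals of \<open>F\<close> against these vanish, so by dominated convergence the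
integral of \<open>F * sgn F = \<bar>F\<bar>\<close> vanishes.
\<close>

lemma AE_0_of_vanishing_moments:
  assumes F: "integrable (lebesgue_on unit_ival) F"
    and orth: "\<And>p :: real poly. (LINT x|lebesgue_on unit_ival. F x * poly p x) = 0"
  shows "AE x in lebesgue_on unit_ival. F x = 0"
proof -
  let ?M = "lebesgue_on unit_ival"
  have Fm: "F \<in> borel_measurable ?M" using F by (rule borel_measurable_integrable)
  define u where "u x = (if x \<in> unit_ival then sgn (F x) else 0)" for x
  have "(\<lambda>x. sgn (F x)) \<in> borel_measurable ?M" using Fm by measurable
  then have "u \<in> borel_measurable lebesgue"
    unfolding u_def by (intro borel_measurable_if_I) auto
  then have "u measurable_on UNIV" by (intro lebesgue_measurable_imp_measurable_on_real) auto
  then obtain N g where N: "negligible N" and g: "\<And>n. continuous_on UNIV (g n)"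
    and lim: "\<And>x. x \<notin> N \<Longrightarrow> (\<lambda>n. g n x) \<longlonglongrightarrow> u x"
    unfolding measurable_on_def by auto
  define h where "h n x = max (-1) (min 1 (g n x))" for n :: nat and x
  have hc: "continuous_on UNIV (h n)" for n
    unfolding h_def using g[of n] by (intro continuous_intros)
  have hm: "h n \<in> borel_measurable ?M" for n
    using hc[of n] continuous_on_subset by (intro continuous_on_imp_measurable_unit_ival) blast
  have hlim: "(\<lambda>n. h n x) \<longlonglongrightarrow> sgn (F x)" if "x \<notin> N" "x \<in> unit_ival" for x
  proof -
    have "(\<lambda>n. h n x) \<longlonglongrightarrow> max (-1) (min 1 (u x))"
      unfolding h_def using lim[OF that(1)] by (intro tendsto_intros)
    moreover have "max (-1) (min 1 (u x)) = sgn (F x)"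
      using that(2) by (simp add: u_def sgn_if)
    ultimately show ?thesis by simp
  qed
  have "N \<in> null_sets lebesgue" using N by (simp add: negligible_iff_null_sets)
  then have "AE x in lebesgue. x \<notin> N" by (rule AE_not_in)
  then have AEN: "AE x in ?M. x \<notin> N \<and> x \<in> unit_ival"
    by (auto simp: AE_restrict_space_iff)
  have "(\<lambda>n. LINT x|?M. F x * h n x) \<longlonglongrightarrow> (LINT x|?M. F x * sgn (F x))"
  proof (rule integral_dominated_convergence[where w = "\<lambda>x. \<bar>F x\<bar>"])
    show "(\<lambda>x. F x * sgn (F x)) \<in> borel_measurable ?M" using Fm by measurable
    show "(\<lambda>x. F x * h n x) \<in> borel_measurable ?M" for n using Fm hm[of n] by measurable
    show "integrable ?M (\<lambda>x. \<bar>F x\<bar>)" using F by simp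
    show "AE x in ?M. (\<lambda>n. F x * h n x) \<longlonglongrightarrow> F x * sgn (F x)"
      using AEN by eventually_elim (intro tendsto_intros hlim, auto)
    show "AE x in ?M. norm (F x * h n x) \<le> \<bar>F x\<bar>" for n
    proof (rule AE_I2)
      fix x
      have "\<bar>h n x\<bar> \<le> 1" by (auto simp: h_def)
      then show "norm (F x * h n x) \<le> \<bar>F x\<bar>"
        using mult_left_mono[of "\<bar>h n x\<bar>" 1 "\<bar>F x\<bar>"] by (simp add: abs_mult)
    qed
  qed
  moreover have "(LINT x|?M. F x * h n x) = 0" for n
    by (rule integral_mult_continuous_eq_0[OF F orth hc])
  ultimately have "(LINT x|?M. F x * sgn (F x)) = 0" by (simp add: LIMSEQ_const_iff)
  then have "(LINT x|?M. \<bar>F x\<bar>) = 0" by (simp add: abs_sgn)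
  then have "AE x in ?M. \<bar>F x\<bar> = 0"
    using F by (subst (asm) integral_nonneg_eq_0_iff_AE) auto
  then show ?thesis by simp
qed

lemma poly_Ck:
  "poly p \<in> Ck k" "Ck_norm k (poly p) = sup_norm (poly p) + sup_norm (poly ((pderiv ^^ k) p))"
proof -
  let ?D = "\<lambda>i. poly ((pderiv ^^ i) p)"
  have chain: "derivative_chain k unit_ival ?D"
    by (auto simp: derivative_chain_def intro!: poly_DERIV)
  have bdd: "bounded (poly q ` unit_ival)" for q :: "real poly"
    using poly_bounded_unit_ival[of q] by (auto simp: bounded_real)
  have cont: "continuous_on unit_ival (?D k)" by (intro continuous_intros)
  show "poly p \<in> Ck k" by (rule Ck_of_chain(1)[OF chain _ cont bdd bdd]) simp
  show "Ck_norm k (poly p) = sup_norm (poly p) + sup_norm (poly ((pderiv ^^ k) p))"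
    using Ck_of_chain(2)[OF chain _ cont bdd bdd, of "poly p"] by simp
qed

lemma L2w_integrable_mult:
  assumes ab: "a > -1" "b > -1" and v: "v \<in> L2w a b"
  shows "integrable (lebesgue_on unit_ival) (\<lambda>x. weight a b x * v x)"
proof (rule Bochner_Integration.integrable_bound)
  let ?M = "lebesgue_on unit_ival"
  have w: "integrable ?M (weight a b)" by (rule integrable_weight[OF ab])
  show "integrable ?M (\<lambda>x. weight a b x + weight a b x * (v x)\<^sup>2)"
    using w v by (simp add: L2w_def)
  show "(\<lambda>x. weight a b x * v x) \<in> borel_measurable ?M"
    using borel_measurable_integrable[OF w] v by (intro borel_measurable_times) (auto simp: L2w_def)
  show "AE x in ?M. norm (weight a b x * v x) \<le> norm (weight a b x + weight a b x * (v x)\<^sup>2)"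
  proof (rule AE_I2)
    fix x
    have "0 \<le> (\<bar>v x\<bar> - 1)\<^sup>2" by simp
    then have "2 * \<bar>v x\<bar> \<le> 1 + (v x)\<^sup>2" by (simp add: power2_diff)
    then have "\<bar>v x\<bar> \<le> 1 + (v x)\<^sup>2" using abs_ge_zero[of "v x"] by linarith
    then have "weight a b x * \<bar>v x\<bar> \<le> weight a b x * (1 + (v x)\<^sup>2)"
      by (rule mult_left_mono) (rule weight_nonneg)
    then show "norm (weight a b x * v x) \<le> norm (weight a b x + weight a b x * (v x)\<^sup>2)"
      using weight_nonneg[of a b x] by (simp add: abs_mult ring_distribs)
  qed
qed

text \<open>
The Jacobi polynomials span all polynomials, so equal coefficients mean equal moments.
\<close>

lemma AE_eq_of_jcoeff_eq:
  assumes ab: "a > -1" "b > -1"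
    and f: "integrable (lebesgue_on unit_ival) (\<lambda>x. weight a b x * f x)"
    and g: "integrable (lebesgue_on unit_ival) (\<lambda>x. weight a b x * g x)"
    and eq: "\<And>j. jcoeff a b f j = jcoeff a b g j"
  shows "AE x in lebesgue_on unit_ival. f x = g x"
proof -
  let ?M = "lebesgue_on unit_ival"
  let ?F = "\<lambda>x. weight a b x * f x - weight a b x * g x"
  have int: "integrable ?M (\<lambda>x. weight a b x * h x * poly p x)"
    if "integrable ?M (\<lambda>x. weight a b x * h x)" for h p
  proof -
    obtain B where "\<forall>x\<in>unit_ival. \<bar>poly p x\<bar> \<le> B" using poly_bounded_unit_ival by blast
    then show ?thesis
      by (intro integrable_mult_bounded[OF that poly_measurable_unit_ival, of _ B]) auto
  qed
  have "(LINT x|?M. ?F x * poly p x) = 0" for p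
  proof -
    obtain c where c: "p = (\<Sum>j\<le>degree p. smult (c j) (njpoly a b j))"
      using poly_in_span_njpoly[OF ab order_refl] by blast
    have F: "integrable ?M (\<lambda>x. ?F x * poly (njpoly a b j) x)" for j
      using Bochner_Integration.integrable_diff[OF int[OF f, of "njpoly a b j"] int[OF g, of "njpoly a b j"]]
      by (simp add: left_diff_distrib)
    have "(LINT x|?M. ?F x * poly (njpoly a b j) x) = jcoeff a b f j - jcoeff a b g j" for j
      unfolding jcoeff_def njacobi_eq_poly left_diff_distrib
      by (rule Bochner_Integration.integral_diff[OF int[OF f] int[OF g]])
    then have 0: "(LINT x|?M. ?F x * poly (njpoly a b j) x) = 0" for j using eq by simp
    have "poly p x = (\<Sum>j\<le>degree p. c j * poly (njpoly a b j) x)" for x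
      by (subst c) (simp add: poly_sum)
    then have "(LINT x|?M. ?F x * poly p x) =
        (LINT x|?M. (\<Sum>j\<le>degree p. c j * (?F x * poly (njpoly a b j) x)))"
      by (simp add: sum_distrib_left mult.left_commute)
    also have "\<dots> = (\<Sum>j\<le>degree p. c j * (LINT x|?M. ?F x * poly (njpoly a b j) x))"
      using F by (subst Bochner_Integration.integral_sum) auto
    finally show ?thesis using 0 by simp
  qed
  then have "AE x in ?M. ?F x = 0"
    by (intro AE_0_of_vanishing_moments) (use f g in auto)
  moreover have "AE x in ?M. x \<in> unit_ival" by (rule AE_I2) simp
  ultimately show ?thesis
  proof eventually_elim
    case (elim x)
    then show ?case using weight_pos[of x a b] by simp
  qed
qed

text \<open>
The second part makes the Jacobi coefficients continuous for convergence in \<open>Ck\<close>.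
\<close>

lemma Ck_weighted_integral:
  assumes ab: "a > -1" "b > -1" and f: "f \<in> Ck k" and p: "\<And>x. x \<in> unit_ival \<Longrightarrow> \<bar>g x\<bar> \<le> B"
    and gm: "g \<in> borel_measurable (lebesgue_on unit_ival)"
  shows "integrable (lebesgue_on unit_ival) (\<lambda>x. weight a b x * f x * g x)"
    and "\<bar>LINT x|lebesgue_on unit_ival. weight a b x * f x * g x\<bar>
      \<le> Ck_norm k f * B * (LINT x|lebesgue_on unit_ival. weight a b x)"
proof -
  let ?M = "lebesgue_on unit_ival"
  have "continuous_on unit_ival f"
  proof (cases k)
    case 0
    then show ?thesis using f by (simp add: Ck_def)
  next
    case (Suc n)
    then have "(f has_field_derivative deriv f x) (at x)" if "x \<in> unit_ival" for x
      using Ck_chain[OF f] that unfolding derivative_chain_def by force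
    then show ?thesis by (intro continuous_at_imp_continuous_on ballI DERIV_isCont)
  qed
  then have fm: "f \<in> borel_measurable ?M" by (rule continuous_on_imp_measurable_unit_ival)
  have fB: "\<bar>f x\<bar> \<le> Ck_norm k f" if "x \<in> unit_ival" for x
    using sup_norm_upper[OF Ck_bounded(1)[OF f] that] sup_norm_nonneg[OF Ck_bounded(2)[OF f]]
    by (simp add: Ck_norm_def)
  have fgB: "\<bar>f x * g x\<bar> \<le> Ck_norm k f * B" if "x \<in> unit_ival" for x
    unfolding abs_mult using fB[OF that] p[OF that] by (intro mult_mono) auto
  have fgm: "(\<lambda>x. f x * g x) \<in> borel_measurable ?M" using fm gm by measurable
  have i: "integrable ?M (\<lambda>x. weight a b x * (f x * g x))"
    by (rule integrable_mult_bounded[OF integrable_weight[OF ab] fgm]) (use fgB in auto)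
  then show "integrable ?M (\<lambda>x. weight a b x * f x * g x)" by (simp add: mult.assoc)
  have "\<bar>LINT x|?M. weight a b x * (f x * g x)\<bar> \<le> (LINT x|?M. \<bar>weight a b x * (f x * g x)\<bar>)"
    by (rule integral_abs_bound)
  also have "\<dots> \<le> (LINT x|?M. Ck_norm k f * B * weight a b x)"
  proof (rule Bochner_Integration.integral_mono)
    show "\<bar>weight a b x * (f x * g x)\<bar> \<le> Ck_norm k f * B * weight a b x" if "x \<in> space ?M" for x
      using mult_right_mono[OF fgB[of x] weight_nonneg[of a b x]] that weight_nonneg[of a b x]
      by (simp add: abs_mult mult.commute mult.left_commute)
  qed (use i integrable_weight[OF ab] in auto)
  finally show "\<bar>LINT x|?M. weight a b x * f x * g x\<bar> \<le> Ck_norm k f * B * (LINT x|?M. weight a b x)"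
    by (simp add: mult.assoc)
qed

lemma jcoeff_partial_sum:
  assumes ab: "a > -1" "b > -1" and "finite A" "j \<in> A"
  shows "jcoeff a b (poly (\<Sum>i\<in>A. smult (c i) (njpoly a b i))) j = c j"
proof -
  have "jcoeff a b (poly p) j = wprod a b (njpoly a b j) p" for p
    unfolding jcoeff_def wprod_def njacobi_eq_poly by (simp add: ac_simps)
  then show ?thesis
    using assms by (simp add: wprod_sum_right wprod_smult_right wprod_njpoly if_distrib[of "(*) _"] sum.delta cong: if_cong)
qed

section \<open>The embedding\<close>

text \<open>
The partial sums of the Jacobi expansion of \<open>v\<close> converge in \<open>Ck k\<close> by the expansion bound for orders \<open>0\<close>
and \<open>k\<close>.  Passing to the limit in their norms and in their coefficients gives the two claims on \<open>w\<close>.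
\<close>

lemma Hs_embedding:
  assumes ab: "a > -1" "b > -1"
    and s: "s > real k + 1 + Max {a + real k, b + real k, - 1 / 2}"
  shows "\<exists>C. \<forall>v\<in>Hs a b s. \<exists>w\<in>Ck k.
    (AE x in lebesgue_on unit_ival. w x = v x) \<and> Ck_norm k w \<le> C * Hs_norm a b s v"
proof -
  let ?M = "lebesgue_on unit_ival"
  have "Max {a + real 0, b + real 0, - 1 / 2} \<le> Max {a + real k, b + real k, - 1 / 2}"
    by (rule Max.boundedI) (auto simp: le_max_iff_disj)
  then have s0: "s > real 0 + 1 + Max {a + real 0, b + real 0, - 1 / 2}"
    using s by linarith
  obtain B0 where B0: "B0 \<ge> 0" "\<And>c m n x. x \<in> unit_ival \<Longrightarrow>
    \<bar>poly (\<Sum>j\<in>{m..<n}. smult (c j) (njpoly a b j)) x\<bar>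
      \<le> B0 * sqrt (\<Sum>j\<in>{m..<n}. (1 + (real j)\<^sup>2) powr s * (c j)\<^sup>2)"
    using jacobi_expansion_bound[OF ab s0] by auto
  obtain Bk where Bk: "Bk \<ge> 0" "\<And>c m n x. x \<in> unit_ival \<Longrightarrow>
    \<bar>poly ((pderiv ^^ k) (\<Sum>j\<in>{m..<n}. smult (c j) (njpoly a b j))) x\<bar>
      \<le> Bk * sqrt (\<Sum>j\<in>{m..<n}. (1 + (real j)\<^sup>2) powr s * (c j)\<^sup>2)"
    using jacobi_expansion_bound[OF ab s] by blast
  define C where "C = B0 + Bk"
  have C: "C \<ge> 0" using B0 Bk by (simp add: C_def)
  have "\<exists>w\<in>Ck k. (AE x in ?M. w x = v x) \<and> Ck_norm k w \<le> C * Hs_norm a b s v"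
    if v: "v \<in> Hs a b s" for v
  proof -
    define c where "c = jcoeff a b v"
    define h where "h = (\<lambda>j. (1 + (real j)\<^sup>2) powr s * (c j)\<^sup>2)"
    have h: "summable h" "\<And>j. 0 \<le> h j" using v by (simp_all add: Hs_def h_def c_def)
    define W where "W m n = (\<Sum>j\<in>{m..<n}. smult (c j) (njpoly a b j))" for m n
    define F where "F n = poly (W 0 n)" for n
    have W: "Ck_norm k (poly (W m n)) \<le> C * sqrt (sum h {m..<n})" for m n
    proof -
      have "sup_norm (poly (W m n)) \<le> B0 * sqrt (sum h {m..<n})"
        unfolding W_def h_def by (rule sup_norm_least) (rule B0(2))
      moreover have "sup_norm (poly ((pderiv ^^ k) (W m n))) \<le> Bk * sqrt (sum h {m..<n})"
        unfolding W_def h_def by (rule sup_norm_least) (rule Bk(2))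
      ultimately show ?thesis by (simp add: poly_Ck(2) C_def ring_distribs)
    qed
    have F: "F n \<in> Ck k" for n unfolding F_def by (rule poly_Ck(1))
    have diff: "(\<lambda>x. F n x - F m x) = poly (W m n)" if "m \<le> n" for m n
    proof -
      have "W 0 n = W 0 m + W m n"
        unfolding W_def using that by (simp add: sum.atLeastLessThan_concat)
      then show ?thesis by (simp add: F_def fun_eq_iff)
    qed
    have cauchy: "\<exists>M. \<forall>m\<ge>M. \<forall>n\<ge>M. Ck_norm k (\<lambda>x. F m x - F n x) < e" if e: "e > 0" for e :: real
    proof -
      \<comment> \<open>\<open>C + 1\<close> because \<open>C\<close> may be \<open>0\<close>.\<close>
      define d where "d = (e / (C + 1))\<^sup>2"
      have "d > 0" using e C by (simp add: d_def)
      then obtain N where N: "\<And>m n. m \<ge> N \<Longrightarrow> norm (sum h {m..<n}) < d"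
        using h(1) unfolding summable_Cauchy by blast
      have small: "Ck_norm k (\<lambda>x. F n x - F m x) < e" if "N \<le> m" "m \<le> n" for m n
      proof -
        have "sum h {m..<n} < d" using N[OF that(1), of n] by simp
        then have "sqrt (sum h {m..<n}) < e / (C + 1)"
          using e C real_sqrt_less_mono[of _ d] by (simp add: d_def)
        then have "sqrt (sum h {m..<n}) + C * sqrt (sum h {m..<n}) < e"
          using C by (simp add: field_simps)
        moreover have "0 \<le> sqrt (sum h {m..<n})" using h(2) by (simp add: sum_nonneg)
        moreover have "Ck_norm k (\<lambda>x. F n x - F m x) \<le> C * sqrt (sum h {m..<n})"
          unfolding diff[OF that(2)] by (rule W)
        ultimately show ?thesis by linarith
      qed
      have "Ck_norm k (\<lambda>x. F m x - F n x) < e" if "N \<le> m" "N \<le> n" for m n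
      proof (cases "m \<le> n")
        case True
        have "(\<lambda>x. F m x - F n x) = (\<lambda>x. (-1) * (F n x - F m x))" by auto
        then have "Ck_norm k (\<lambda>x. F m x - F n x) = Ck_norm k (\<lambda>x. F n x - F m x)"
          using Ck_scale(2)[OF Ck_diff(1)[OF F F], of "-1" n m] by simp
        then show ?thesis using small[OF that(1) True] by simp
      next
        case False
        then show ?thesis using small[OF that(2)] by simp
      qed
      then show ?thesis by blast
    qed
    obtain w where w: "w \<in> Ck k" "(\<lambda>n. Ck_norm k (\<lambda>x. F n x - w x)) \<longlonglongrightarrow> 0"
      using Ck_complete[OF F cauchy] by blast
    have Fw: "(\<lambda>x. F n x - w x) \<in> Ck k" for n by (rule Ck_diff(1)[OF F w(1)])
    have "Ck_norm k w \<le> C * Hs_norm a b s v"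
    proof (rule LIMSEQ_le_const)
      show "(\<lambda>n. C * Hs_norm a b s v + Ck_norm k (\<lambda>x. F n x - w x)) \<longlonglongrightarrow> C * Hs_norm a b s v"
        using tendsto_add[OF tendsto_const w(2)] by simp
      have "Ck_norm k w \<le> C * Hs_norm a b s v + Ck_norm k (\<lambda>x. F n x - w x)" for n
      proof -
        have "w = (\<lambda>x. F n x + (-1) * (F n x - w x))" by auto
        then have "Ck_norm k w \<le> Ck_norm k (F n) + Ck_norm k (\<lambda>x. (-1) * (F n x - w x))"
          using Ck_add(2)[OF F Ck_scale(1)[OF Fw]] by metis
        also have "Ck_norm k (\<lambda>x. (-1) * (F n x - w x)) = Ck_norm k (\<lambda>x. F n x - w x)"
          using Ck_scale(2)[OF Fw, of "-1" n] by simp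
        also have "Ck_norm k (F n) \<le> C * sqrt (sum h {0..<n})" unfolding F_def by (rule W)
        also have "sqrt (sum h {0..<n}) \<le> Hs_norm a b s v"
          unfolding Hs_norm_def c_def[symmetric] h_def[symmetric]
          using h by (intro real_sqrt_le_mono sum_le_suminf) auto
        finally show ?thesis using C by (simp add: mult_left_mono)
      qed
      then show "\<exists>N. \<forall>n\<ge>N. Ck_norm k w \<le> C * Hs_norm a b s v + Ck_norm k (\<lambda>x. F n x - w x)" by blast
    qed
    moreover have "AE x in ?M. w x = v x"
    proof (rule AE_eq_of_jcoeff_eq[OF ab])
      show "integrable ?M (\<lambda>x. weight a b x * w x)"
        using Ck_weighted_integral(1)[OF ab w(1), of "\<lambda>_. 1" 1] by simp
      show "integrable ?M (\<lambda>x. weight a b x * v x)"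
        using v by (intro L2w_integrable_mult[OF ab]) (simp add: Hs_def)
      fix j
      obtain B where B: "\<And>x. x \<in> unit_ival \<Longrightarrow> \<bar>poly (njpoly a b j) x\<bar> \<le> B"
        using poly_bounded_unit_ival by blast
      note int = Ck_weighted_integral[OF ab _ B poly_measurable_unit_ival]
      define R where "R = B * (LINT x|?M. weight a b x)"
      have "(\<lambda>n. jcoeff a b (F n) j - jcoeff a b w j) \<longlonglongrightarrow> 0"
      proof (rule Lim_null_comparison)
        show "(\<lambda>n. Ck_norm k (\<lambda>x. F n x - w x) * R) \<longlonglongrightarrow> 0"
          using tendsto_mult_left_zero[OF w(2)] by simp
        have "norm (jcoeff a b (F n) j - jcoeff a b w j) \<le> Ck_norm k (\<lambda>x. F n x - w x) * R" for n
        proof -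
          have "jcoeff a b (F n) j - jcoeff a b w j =
              (LINT x|?M. weight a b x * (F n x - w x) * poly (njpoly a b j) x)"
            unfolding jcoeff_def njacobi_eq_poly left_diff_distrib right_diff_distrib
            by (rule Bochner_Integration.integral_diff[symmetric, OF int(1)[OF F] int(1)[OF w(1)]])
          then show ?thesis using int(2)[OF Fw, of n] by (simp add: R_def mult.assoc)
        qed
        then show "\<forall>\<^sub>F n in sequentially. norm (jcoeff a b (F n) j - jcoeff a b w j)
            \<le> Ck_norm k (\<lambda>x. F n x - w x) * R" by simp
      qed
      moreover have "\<forall>\<^sub>F n in sequentially. jcoeff a b (F n) j - jcoeff a b w j = c j - jcoeff a b w j"
        using eventually_gt_at_top[of j]
      proof eventually_elim
        case (elim n)
        then show ?case unfolding F_def W_def by (simp add: jcoeff_partial_sum[OF ab])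
      qed
      ultimately have "(\<lambda>n. c j - jcoeff a b w j) \<longlonglongrightarrow> 0"
        by (rule Lim_transform_eventually)
      then show "jcoeff a b w j = jcoeff a b v j" by (simp add: LIMSEQ_const_iff c_def)
    qed
    ultimately show ?thesis using w(1) by blast
  qed
  then show ?thesis by blast
qed

theorem theorem2:
  fixes a b s :: real and k :: nat
  assumes "a > -1" and "b > -1"
    and "s > real k + 1 + Max {a + real k, b + real k, - 1 / 2}"
  shows "banach_fun_space unit_ival (Ck k) (Ck_norm k) \<and>
         (\<exists>C. \<forall>v\<in>Hs a b s. \<exists>w\<in>Ck k.
            (AE x in lebesgue_on unit_ival. w x = v x) \<and>
            Ck_norm k w \<le> C * Hs_norm a b s v)"
  using Ck_banach Hs_embedding[OF assms] by blast

end
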